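(* Let $m\ge1$ be an integer and let the density $p$ be $m$ times differentiable on $\mathbb{R}$ with $p^{(m)}$ a function of bounded variation, $\mathbf{V}(p^{(m)})=V_m<\infty$. If $p_n=p_{n,h_n}$ is the sinc estimator with $h_n=h_0n^{-1/(2m+1)}$ for some constant $h_0>0$, then $$\mathrm{MISE}(p_n)\le\frac1{2\pi}\Bigl\{\frac{4(m+1)}{2m+1}V_m^{(2m+1)/(m+1)}h_0^{2m}+\frac2{h_0}\Bigr\}n^{-2m/(2m+1)}.$$
   Context: Let $X_1,\dots,X_n$ be i.i.d. real random variables with probability density $p$. The sinc kernel is $K(x)=\frac{\sin x}{\pi x}$ (with $K(0)=1/\pi$); the sinc estimator with bandwidth $h>0$ is $p_{n,h}(x)=\frac1{nh}\sum_{j=1}^nK\bigl((x-X_j)/h\bigr)$, equivalently $p_{n,h}(x)=\frac1{2\pi}\int_{-1/h}^{1/h}e^{-itx}f_n(t)\,dt$ with $f_n(t)=\frac1n\sum_{j=1}^ne^{itX_j}$. Define $\mathrm{MISE}(p_{n,h})=\mathrm{E}\int\{p_{n,h}(x)-p(x)\}^2\,dx$. $\mathbf{V}(g)$ is the total variation of $g$ over the whole real line. *)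

theory Defs
  imports "HOL-Probability.Probability"
begin

definition sinc_kernel :: "real \<Rightarrow> real" where
  "sinc_kernel x = sinc x / pi"

definition sinc_estimator :: "(nat \<Rightarrow> 'a \<Rightarrow> real) \<Rightarrow> nat \<Rightarrow> real \<Rightarrow> 'a \<Rightarrow> real \<Rightarrow> real" where
  "sinc_estimator X n h \<omega> x = 1 / (real n * h) * (\<Sum>j=1..n. sinc_kernel ((x - X j \<omega>) / h))"

(* Both integrals take values in [0,\<infinity>], so a bound on the MISE includes its finiteness. *)
definition MISE :: "'a measure \<Rightarrow> ('a \<Rightarrow> real \<Rightarrow> real) \<Rightarrow> (real \<Rightarrow> real) \<Rightarrow> ennreal" where
  "MISE M q p = (\<integral>\<^sup>+ \<omega>. (\<integral>\<^sup>+ x. ennreal ((q \<omega> x - p x)\<^sup>2) \<partial>lborel) \<partial>M)"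

definition total_variation :: "(real \<Rightarrow> real) \<Rightarrow> ennreal" where
  "total_variation g =
     (SUP t\<in>{t :: nat \<Rightarrow> real. mono t}. SUP k. \<Sum>i<k. ennreal \<bar>g (t (Suc i)) - g (t i)\<bar>)"

definition times_differentiable :: "nat \<Rightarrow> (real \<Rightarrow> real) \<Rightarrow> bool" where
  "times_differentiable m g \<longleftrightarrow> (\<forall>k<m. (deriv ^^ k) g differentiable_on UNIV)"

end

theory Submission
  imports Defs "HOL-Real_Asymp.Real_Asymp"
begin

text \<open>
  Let f be the characteristic function of p. Taking m + 1 forward differences of step s costs
  a factor s per difference in the L1 norm, the last one against the total variation, while it
  multiplies f(t) by the (m + 1)-st power of exp(- i s t) - 1. Letting s tend to 0 gives
  \<open>\<bar>t\<bar>\<^bsup>m+1\<^esup> \<bar>f t\<bar> \<le> V\<close> without integrating by parts, so no decay of the derivatives of p at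
  infinity has to be shown. Hence f is integrable, Fourier inversion holds, and the error of the
  estimator is an inverse Fourier transform; only the inequality half of Plancherel's theorem is
  needed to bound its L2 norm. On \<open>\<bar>t\<bar> \<le> 1/h\<close> the empirical characteristic function has
  mean square error at most 1/n, and on \<open>\<bar>t\<bar> > 1/h\<close> the bound \<open>\<bar>f t\<bar> \<le> min 1 (a/\<bar>t\<bar>)\<^bsup>m+1\<^esup>\<close>
  with \<open>a\<^bsup>m+1\<^esup> = V\<close> is integrated, distinguishing \<open>a \<le> 1/h\<close> from \<open>a > 1/h\<close>.
\<close>

section \<open>Iterated differences and bounded variation\<close>

text \<open>The value type is an arbitrary abelian group, so that one operator acts both on the real
  density and on its complex embedding, whose transform is taken.\<close>

definition forward_diff :: "real \<Rightarrow> (real \<Rightarrow> 'a::ab_group_add) \<Rightarrow> real \<Rightarrow> 'a" where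
  "forward_diff s g x = g (x + s) - g x"

lemma forward_diff_iterate_Suc:
  "(forward_diff s ^^ Suc k) g = (\<lambda>x. (forward_diff s ^^ k) g (x + s) - (forward_diff s ^^ k) g x)"
  by (simp add: fun_eq_iff forward_diff_def)

lemma measurable_forward_diff_iterate:
  fixes g :: "real \<Rightarrow> 'a::euclidean_space"
  assumes "g \<in> borel_measurable borel"
  shows "(forward_diff s ^^ k) g \<in> borel_measurable borel"
proof (induction k)
  case (Suc k)
  note [measurable] = Suc
  show ?case unfolding forward_diff_iterate_Suc by measurable
qed (simp add: assms)

text \<open>Half-open blocks tile without overlap, so the indicators add up exactly, including at
  the endpoints.\<close>

lemma sum_indicator_consecutive_intervals:
  fixes a s :: real
  assumes "s > 0"
  shows "(\<Sum>i<n. indicator {a + real i * s ..< a + (real i + 1) * s} x :: ennreal) = indicator {a ..< a + real n * s} x"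
proof (induction n)
  case (Suc n)
  define r where "r = real n * s"
  have r: "0 \<le> r" "(real n + 1) * s = r + s" "real (Suc n) * s = r + s"
    using assms by (simp_all add: r_def distrib_right)
  have "(\<Sum>i<Suc n. indicator {a + real i * s ..< a + (real i + 1) * s} x :: ennreal)
      = indicator {a ..< a + r} x + indicator {a + r ..< a + (r + s)} x"
    by (simp only: sum.lessThan_Suc Suc.IH r r_def[symmetric])
  also have "\<dots> = indicator {a ..< a + real (Suc n) * s} x"
    unfolding r(3) using r(1) assms by (auto simp: indicator_def)
  finally show ?case .
qed simp

text \<open>Cut the line into blocks of length \<open>s\<close> and translate all of them to
  \<open>{0 ..< s}\<close>. For each offset \<open>y\<close> the integrand summed over the blocks is
  a variation sum of \<open>g\<close> along an arithmetic progression, so it is at most the total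
  variation; integrating over \<open>y\<close> gives the factor \<open>s\<close>.\<close>

lemma nn_integral_forward_diff_le_total_variation:
  fixes g :: "real \<Rightarrow> real"
  assumes [measurable]: "g \<in> borel_measurable borel" and s: "s > 0"
  shows "(\<integral>\<^sup>+x. ennreal \<bar>g (x + s) - g x\<bar> \<partial>lborel) \<le> ennreal s * total_variation g"
proof -
  define F where "F x = ennreal \<bar>g (x + s) - g x\<bar>" for x
  have [measurable]: "F \<in> borel_measurable borel" unfolding F_def[abs_def] by measurable
  \<comment> \<open>Window number \<open>N\<close> consists of exactly \<open>2 * N\<close> blocks,
    so \<open>block\<close> applies to it, and the windows exhaust the line.\<close>
  define A where "A N = {- real N * s ..< real N * s}" for N
  have [measurable]: "A N \<in> sets borel" for N by (simp add: A_def)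
  have block: "(\<integral>\<^sup>+x. F x * indicator {a ..< a + real n * s} x \<partial>lborel) \<le> ennreal s * total_variation g" for a n
  proof -
    have "(\<integral>\<^sup>+x. F x * indicator {a ..< a + real n * s} x \<partial>lborel)
        = (\<integral>\<^sup>+x. (\<Sum>i<n. F x * indicator {a + real i * s ..< a + (real i + 1) * s} x) \<partial>lborel)"
      unfolding sum_indicator_consecutive_intervals[OF s, symmetric] sum_distrib_left ..
    also have "\<dots> = (\<Sum>i<n. \<integral>\<^sup>+x. F x * indicator {a + real i * s ..< a + (real i + 1) * s} x \<partial>lborel)"
      by (rule nn_integral_sum) measurable
    also have "\<dots> = (\<Sum>i<n. \<integral>\<^sup>+y. F ((a + real i * s) + y) * indicator {0 ..< s} y \<partial>lborel)"
      by (rule sum.cong[OF refl], subst nn_integral_real_affine[where c=1 and t="a + real _ * s"])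
         (auto intro!: nn_integral_cong simp: indicator_def algebra_simps)
    also have "\<dots> = (\<integral>\<^sup>+y. (\<Sum>i<n. F ((a + real i * s) + y) * indicator {0 ..< s} y) \<partial>lborel)"
      by (rule nn_integral_sum[symmetric]) measurable
    also have "\<dots> \<le> (\<integral>\<^sup>+y. total_variation g * indicator {0 ..< s} y \<partial>lborel)"
    proof (intro nn_integral_mono)
      fix y
      let ?t = "\<lambda>i. a + real i * s + y"
      have "mono ?t" using s by (auto intro!: monoI mult_right_mono)
      then have "(\<Sum>i<n. ennreal \<bar>g (?t (Suc i)) - g (?t i)\<bar>) \<le> total_variation g"
        unfolding total_variation_def by (intro SUP_upper2[of ?t] SUP_upper2[of n]) auto
      moreover have "?t (Suc i) = ?t i + s" for i by (simp add: algebra_simps)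
      ultimately have "(\<Sum>i<n. F (?t i)) \<le> total_variation g"
        unfolding F_def by (simp only:)
      then show "(\<Sum>i<n. F (?t i) * indicator {0 ..< s} y) \<le> total_variation g * indicator {0 ..< s} y"
        unfolding sum_distrib_right[symmetric] by (rule mult_right_mono) simp
    qed
    also have "\<dots> = ennreal s * total_variation g"
      using s by (simp add: nn_integral_cmult_indicator mult.commute)
    finally show ?thesis .
  qed
  have cover: "(\<Union>N. A N) = UNIV"
  proof -
    have "x \<in> (\<Union>N. A N)" for x
    proof -
      obtain N where "\<bar>x\<bar> / s < real N" using reals_Archimedean2 by blast
      then have "\<bar>x\<bar> < real N * s" using s by (simp add: field_simps)
      then have "x \<in> A N" unfolding A_def by auto
      then show ?thesis by blast
    qed
    then show ?thesis by auto
  qed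
  have inc: "incseq A"
  proof (rule incseq_SucI)
    fix N show "A N \<subseteq> A (Suc N)" using s by (auto simp: A_def algebra_simps)
  qed
  have "(\<integral>\<^sup>+x. F x \<partial>lborel) = emeasure (density lborel F) (\<Union>N. A N)"
    unfolding cover by (simp add: emeasure_density)
  \<comment> \<open>Monotone convergence, read as continuity from below of the measure with density
    \<open>F\<close>.\<close>
  also have "\<dots> = (SUP N. emeasure (density lborel F) (A N))"
    by (rule SUP_emeasure_incseq[symmetric]) (use inc in auto)
  also have "\<dots> \<le> ennreal s * total_variation g"
  proof (rule SUP_least)
    fix N
    have "A N = {- real N * s ..< - real N * s + real (2 * N) * s}"
      unfolding A_def by (simp add: algebra_simps)
    then show "emeasure (density lborel F) (A N) \<le> ennreal s * total_variation g"
      using block[of "- real N * s" "2 * N"] by (simp add: emeasure_density A_def)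
  qed
  finally show ?thesis unfolding F_def .
qed

text \<open>The fundamental theorem of calculus for a derivative that may be discontinuous. An
  infinite right-hand side makes the bound trivial; a finite one makes \<open>G'\<close> integrable
  on the interval.\<close>

lemma abs_diff_le_nn_integral_deriv:
  fixes G G' :: "real \<Rightarrow> real"
  assumes G: "\<And>x. (G has_real_derivative G' x) (at x)"
    and [measurable]: "G' \<in> borel_measurable borel" and "a \<le> b"
  shows "ennreal \<bar>G b - G a\<bar> \<le> (\<integral>\<^sup>+x. ennreal \<bar>G' x\<bar> * indicator {a..b} x \<partial>lborel)"
proof (cases "(\<integral>\<^sup>+x. ennreal \<bar>G' x\<bar> * indicator {a..b} x \<partial>lborel) < \<infinity>")
  case True
  have eq: "ennreal \<bar>G' x\<bar> * indicator {a..b} x = ennreal (norm (indicator {a..b} x *\<^sub>R G' x))" for x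
    by (auto simp: indicator_def)
  have int: "integrable lborel (\<lambda>x. indicator {a..b} x *\<^sub>R G' x)"
    using True unfolding eq by (intro integrableI_bounded) auto
  then have si: "set_integrable lborel {a..b} G'" unfolding set_integrable_def .
  \<comment> \<open>This is a gauge integral, which exists for every derivative; integrability then
    identifies it with the Lebesgue integral.\<close>
  have "(G' has_integral (G b - G a)) {a..b}"
    by (rule fundamental_theorem_of_calculus[OF \<open>a \<le> b\<close>])
       (meson G has_real_derivative_iff_has_vector_derivative has_vector_derivative_at_within)
  then have "G b - G a = (LINT x:{a..b}|lborel. G' x)"
    using set_borel_integral_eq_integral(2)[OF si] by (simp add: integral_unique)
  then have "\<bar>G b - G a\<bar> \<le> (\<integral>x. norm (indicator {a..b} x *\<^sub>R G' x) \<partial>lborel)"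
    unfolding set_lebesgue_integral_def using integral_norm_bound[of lborel "\<lambda>x. indicator {a..b} x *\<^sub>R G' x"] by simp
  then have "ennreal \<bar>G b - G a\<bar> \<le> ennreal (\<integral>x. norm (indicator {a..b} x *\<^sub>R G' x) \<partial>lborel)"
    by (rule ennreal_leI)
  also have "\<dots> = (\<integral>\<^sup>+x. ennreal (norm (indicator {a..b} x *\<^sub>R G' x)) \<partial>lborel)"
    by (rule nn_integral_eq_integral[symmetric]) (use int in auto)
  finally show ?thesis unfolding eq .
next
  case False
  then have "(\<integral>\<^sup>+x. ennreal \<bar>G' x\<bar> * indicator {a..b} x \<partial>lborel) = \<top>"
    by (simp only: less_top not_less infinity_ennreal_def top.extremum_unique)
  then show ?thesis by (simp only: top_greatest)
qed

text \<open>The increment over \<open>{x..x+s}\<close> is at most the integral of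
  \<open>\<bar>G'\<bar>\<close> there. After exchanging the integrals, each shift by
  \<open>u\<close> in \<open>{0..s}\<close> contributes the same L1 norm. Both sides may be
  infinite.\<close>

lemma nn_integral_forward_diff_le_deriv:
  fixes G G' :: "real \<Rightarrow> real"
  assumes G: "\<And>x. (G has_real_derivative G' x) (at x)"
    and [measurable]: "G' \<in> borel_measurable borel" and s: "s > 0"
  shows "(\<integral>\<^sup>+x. ennreal \<bar>G (x + s) - G x\<bar> \<partial>lborel) \<le> ennreal s * (\<integral>\<^sup>+x. ennreal \<bar>G' x\<bar> \<partial>lborel)"
proof -
  have "(\<integral>\<^sup>+x. ennreal \<bar>G (x + s) - G x\<bar> \<partial>lborel)
      \<le> (\<integral>\<^sup>+x. (\<integral>\<^sup>+u. ennreal \<bar>G' (x + u)\<bar> * indicator {0..s} u \<partial>lborel) \<partial>lborel)"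
  proof (rule nn_integral_mono)
    fix x
    have "ennreal \<bar>G (x + s) - G x\<bar> \<le> (\<integral>\<^sup>+y. ennreal \<bar>G' y\<bar> * indicator {x..x+s} y \<partial>lborel)"
      using s by (intro abs_diff_le_nn_integral_deriv G) auto
    also have "\<dots> = (\<integral>\<^sup>+u. ennreal \<bar>G' (x + u)\<bar> * indicator {0..s} u \<partial>lborel)"
      by (subst nn_integral_real_affine[where c=1 and t=x])
         (auto intro!: nn_integral_cong simp: indicator_def)
    finally show "ennreal \<bar>G (x + s) - G x\<bar> \<le> (\<integral>\<^sup>+u. ennreal \<bar>G' (x + u)\<bar> * indicator {0..s} u \<partial>lborel)" .
  qed
  also have "\<dots> = (\<integral>\<^sup>+u. (\<integral>\<^sup>+x. ennreal \<bar>G' (x + u)\<bar> * indicator {0..s} u \<partial>lborel) \<partial>lborel)"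
    by (rule lborel_pair.Fubini') measurable
  also have "\<dots> = (\<integral>\<^sup>+u. (\<integral>\<^sup>+x. ennreal \<bar>G' x\<bar> \<partial>lborel) * indicator {0..s} u \<partial>lborel)"
  proof (rule nn_integral_cong)
    fix u :: real
    show "(\<integral>\<^sup>+x. ennreal \<bar>G' (x + u)\<bar> * indicator {0..s} u \<partial>lborel) = (\<integral>\<^sup>+x. ennreal \<bar>G' x\<bar> \<partial>lborel) * indicator {0..s} u"
      by (subst (2) nn_integral_real_affine[where c=1 and t=u])
         (auto simp: nn_integral_multc add.commute)
  qed
  also have "\<dots> = ennreal s * (\<integral>\<^sup>+x. ennreal \<bar>G' x\<bar> \<partial>lborel)"
    using s by (subst nn_integral_cmult_indicator) (simp_all add: mult.commute)
  finally show ?thesis .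
qed

text \<open>The derivative is the pointwise limit of the difference quotients with increments
  \<open>1 / (n + 1)\<close>, which are measurable because \<open>g\<close> is continuous.\<close>

lemma borel_measurable_deriv_of_differentiable:
  fixes g :: "real \<Rightarrow> real"
  assumes g: "g differentiable_on UNIV"
  shows "deriv g \<in> borel_measurable borel"
proof (rule borel_measurable_LIMSEQ_real)
  fix x
  have "(g has_real_derivative deriv g x) (at x)"
    using g by (metis DERIV_deriv_iff_real_differentiable differentiable_on_def UNIV_I)
  then have "((\<lambda>h. (g (x + h) - g x) / h) \<longlongrightarrow> deriv g x) (at 0)"
    by (simp add: DERIV_def)
  moreover have "filterlim (\<lambda>n. inverse (real (Suc n))) (at 0) sequentially"
    unfolding filterlim_at using LIMSEQ_inverse_real_of_nat by simp
  ultimately show "(\<lambda>n. (g (x + inverse (real (Suc n))) - g x) / inverse (real (Suc n))) \<longlonglongrightarrow> deriv g x"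
    by (rule filterlim_compose)
next
  fix n
  have "continuous_on UNIV g" using g by (rule differentiable_imp_continuous_on)
  then have [measurable]: "g \<in> borel_measurable borel" by (rule borel_measurable_continuous_onI)
  show "(\<lambda>x. (g (x + inverse (real (Suc n))) - g x) / inverse (real (Suc n))) \<in> borel_measurable borel"
    by measurable
qed

lemma has_real_derivative_forward_diff_iterate:
  fixes g g' :: "real \<Rightarrow> real"
  assumes "\<And>x. (g has_real_derivative g' x) (at x)"
  shows "((forward_diff s ^^ k) g has_real_derivative (forward_diff s ^^ k) g' x) (at x)"
proof (induction k arbitrary: x)
  case (Suc k)
  show ?case unfolding forward_diff_iterate_Suc
    by (intro DERIV_diff Suc DERIV_shift[THEN iffD1])
qed (simp add: assms)

text \<open>Differencing commutes with differentiation, so the outermost difference can be traded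
  for a factor \<open>s\<close> and one derivative of \<open>g\<close>; hence the induction
  generalises over \<open>g\<close>. The single difference left at the end is paid for by the total
  variation. Measurability is a separate assumption because the case \<open>m = 0\<close> gives no
  regularity.\<close>

lemma nn_integral_forward_diff_iterate_le:
  fixes g :: "real \<Rightarrow> real"
  assumes "times_differentiable m g" and "g \<in> borel_measurable borel" and s: "s > 0"
  shows "(\<integral>\<^sup>+x. ennreal \<bar>(forward_diff s ^^ Suc m) g x\<bar> \<partial>lborel)
    \<le> ennreal s ^ Suc m * total_variation ((deriv ^^ m) g)"
  using assms(1,2)
proof (induction m arbitrary: g)
  case 0
  then show ?case using nn_integral_forward_diff_le_total_variation[OF _ s]
    by (simp add: forward_diff_def)
next
  case (Suc m)
  have g: "g differentiable_on UNIV"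
    using Suc.prems(1) unfolding times_differentiable_def by (metis funpow_0 zero_less_Suc)
  have td: "times_differentiable m (deriv g)"
    using Suc.prems(1) unfolding times_differentiable_def
    by (metis Suc_less_eq comp_apply funpow_Suc_right)
  have dm: "deriv g \<in> borel_measurable borel"
    by (rule borel_measurable_deriv_of_differentiable[OF g])
  have der: "(g has_real_derivative deriv g x) (at x)" for x
    using g by (metis DERIV_deriv_iff_real_differentiable differentiable_on_def UNIV_I)
  have "(\<integral>\<^sup>+x. ennreal \<bar>(forward_diff s ^^ Suc (Suc m)) g x\<bar> \<partial>lborel)
     = (\<integral>\<^sup>+x. ennreal \<bar>(forward_diff s ^^ Suc m) g (x + s) - (forward_diff s ^^ Suc m) g x\<bar> \<partial>lborel)"
    by (simp only: forward_diff_iterate_Suc[where k="Suc m"])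
  also have "\<dots> \<le> ennreal s * (\<integral>\<^sup>+x. ennreal \<bar>(forward_diff s ^^ Suc m) (deriv g) x\<bar> \<partial>lborel)"
    by (rule nn_integral_forward_diff_le_deriv[OF has_real_derivative_forward_diff_iterate[OF der]
          measurable_forward_diff_iterate[OF dm] s])
  also have "\<dots> \<le> ennreal s * (ennreal s ^ Suc m * total_variation ((deriv ^^ m) (deriv g)))"
    by (intro mult_left_mono Suc.IH td dm) simp
  also have "\<dots> = ennreal s ^ Suc (Suc m) * total_variation ((deriv ^^ Suc m) g)"
    by (simp add: mult.assoc funpow_swap1)
  finally show ?case .
qed

section \<open>Fourier transform and its decay\<close>

text \<open>The convention of characteristic functions: positive sign in the exponent and no
  normalising constant. The inverse transform is therefore \<open>fourier\<close> at the reflected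
  point divided by \<open>2 * pi\<close>.\<close>

definition fourier :: "(real \<Rightarrow> complex) \<Rightarrow> real \<Rightarrow> complex" where
  "fourier g t = (\<integral>x. cis (t * x) * g x \<partial>lborel)"

lemma borel_measurable_cis [measurable]: "cis \<in> borel_measurable borel"
  by (intro borel_measurable_continuous_onI continuous_intros)

lemma integrable_cis_mult:
  assumes "integrable lborel g"
  shows "integrable lborel (\<lambda>x. cis (t * x) * g x)"
proof -
  have [measurable]: "g \<in> borel_measurable borel" using assms by auto
  show ?thesis by (rule Bochner_Integration.integrable_bound[OF assms]) (auto simp: norm_mult)
qed

lemma norm_fourier_le: "cmod (fourier g t) \<le> (\<integral>x. cmod (g x) \<partial>lborel)"
  unfolding fourier_def using integral_norm_bound[of lborel "\<lambda>x. cis (t * x) * g x"] by (simp add: norm_mult)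

lemma borel_measurable_fourier [measurable]:
  assumes [measurable]: "g \<in> borel_measurable borel"
  shows "fourier g \<in> borel_measurable borel"
  unfolding fourier_def[abs_def] by measurable

lemma fourier_diff:
  assumes "integrable lborel a" "integrable lborel b"
  shows "fourier (\<lambda>t. a t - b t) x = fourier a x - fourier b x"
  using integrable_cis_mult[OF assms(1)] integrable_cis_mult[OF assms(2)]
  by (simp add: fourier_def right_diff_distrib)

lemma fourier_sum:
  assumes "\<And>j. j \<in> J \<Longrightarrow> integrable lborel (a j)"
  shows "fourier (\<lambda>t. \<Sum>j\<in>J. a j t) x = (\<Sum>j\<in>J. fourier (a j) x)"
  unfolding fourier_def sum_distrib_left
  by (intro Bochner_Integration.integral_sum integrable_cis_mult assms)

lemma fourier_divide: "fourier (\<lambda>t. a t / c) x = fourier a x / c"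
  by (simp add: fourier_def)

lemma fourier_shift:
  "fourier (\<lambda>x. g (x + s)) t = cis (- (t * s)) * fourier g t"
proof -
  have "fourier g t = (\<integral>x. cis (t * (s + x)) * g (s + x) \<partial>lborel)"
    unfolding fourier_def by (subst lborel_integral_real_affine[where c=1 and t=s]) auto
  also have "\<dots> = (\<integral>x. cis (t * s) * (cis (t * x) * g (x + s)) \<partial>lborel)"
    by (simp add: distrib_left cis_mult[symmetric] mult.assoc mult.left_commute[of "cis (t * s)"] add.commute)
  also have "\<dots> = cis (t * s) * fourier (\<lambda>x. g (x + s)) t"
    by (simp add: fourier_def)
  finally show ?thesis by (simp add: mult.assoc[symmetric] cis_mult)
qed

lemma integrable_forward_diff_iterate:
  fixes g :: "real \<Rightarrow> 'a::euclidean_space"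
  assumes "integrable lborel g"
  shows "integrable lborel ((forward_diff s ^^ k) g)"
proof (induction k)
  case (Suc k)
  then show ?case unfolding forward_diff_iterate_Suc
    using lborel_integrable_real_affine[of "(forward_diff s ^^ k) g" 1 s]
    by (simp add: add.commute)
qed (simp add: assms)

lemma fourier_forward_diff_iterate:
  assumes g: "integrable lborel g"
  shows "fourier ((forward_diff s ^^ k) g) t = (cis (- (t * s)) - 1) ^ k * fourier g t"
proof (induction k)
  case (Suc k)
  let ?G = "(forward_diff s ^^ k) g"
  have G: "integrable lborel ?G" by (rule integrable_forward_diff_iterate[OF g])
  have G': "integrable lborel (\<lambda>x. ?G (x + s))"
    using lborel_integrable_real_affine[OF G, of 1 s] by (simp add: add.commute)
  have "fourier ((forward_diff s ^^ Suc k) g) t = fourier (\<lambda>x. ?G (x + s)) t - fourier ?G t"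
    unfolding forward_diff_iterate_Suc by (rule fourier_diff[OF G' G])
  then show ?case by (simp add: fourier_shift Suc algebra_simps)
qed simp

lemma forward_diff_iterate_of_real:
  "(forward_diff s ^^ k) (\<lambda>x. complex_of_real (g x)) = (\<lambda>x. complex_of_real ((forward_diff s ^^ k) g x))"
proof (induction k)
  case (Suc k)
  show ?case unfolding forward_diff_iterate_Suc Suc by simp
qed simp

text \<open>Transforming the iterated difference and dividing by \<open>s ^ Suc m\<close> bounds
  \<open>\<bar>(cis (- (t * s)) - 1) / s\<bar> ^ Suc m\<close> times the modulus of the transform by
  \<open>V\<close>, uniformly in \<open>s > 0\<close>; the base tends to
  \<open>\<bar>t\<bar>\<close> as \<open>s\<close> tends to 0.\<close>

lemma fourier_decay:
  fixes g :: "real \<Rightarrow> real"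
  assumes "times_differentiable m g" and g: "integrable lborel g"
    and V: "total_variation ((deriv ^^ m) g) = ennreal V" "0 \<le> V"
  shows "\<bar>t\<bar> ^ Suc m * cmod (fourier (\<lambda>x. complex_of_real (g x)) t) \<le> V"
proof -
  let ?f = "cmod (fourier (\<lambda>x. complex_of_real (g x)) t)"
  have [measurable]: "g \<in> borel_measurable borel" using g by auto
  have bound: "\<bar>2 * sin (t * s / 2) / s\<bar> ^ Suc m * ?f \<le> V" if s: "s > 0" for s
  proof -
    let ?D = "(forward_diff s ^^ Suc m) g"
    have D: "integrable lborel ?D" by (rule integrable_forward_diff_iterate[OF g])
    have "ennreal (\<integral>x. \<bar>?D x\<bar> \<partial>lborel) = (\<integral>\<^sup>+x. ennreal \<bar>?D x\<bar> \<partial>lborel)"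
      using D by (intro nn_integral_eq_integral[symmetric]) auto
    also have "\<dots> \<le> ennreal s ^ Suc m * ennreal V"
      using nn_integral_forward_diff_iterate_le[OF assms(1) _ s] unfolding V by simp
    also have "\<dots> = ennreal (s ^ Suc m * V)"
      using s V by (simp add: ennreal_mult ennreal_power[symmetric] del: power_Suc)
    finally have "(\<integral>x. \<bar>?D x\<bar> \<partial>lborel) \<le> s ^ Suc m * V"
      using s V by (subst (asm) ennreal_le_iff) auto
    moreover have "cmod (fourier ((forward_diff s ^^ Suc m) (\<lambda>x. complex_of_real (g x))) t) \<le> (\<integral>x. \<bar>?D x\<bar> \<partial>lborel)"
      using norm_fourier_le[of "\<lambda>x. complex_of_real (?D x)" t] unfolding forward_diff_iterate_of_real by simp
    \<comment> \<open>The length of a chord of the unit circle.\<close>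
    moreover have "cmod (cis (- (t * s)) - 1) = \<bar>2 * sin (t * s / 2)\<bar>"
      using dist_exp_i_1[of "- (t * s)"] by (simp add: abs_mult cis_conv_exp)
    ultimately have "\<bar>2 * sin (t * s / 2)\<bar> ^ Suc m * ?f \<le> s ^ Suc m * V"
      using g by (subst (asm) fourier_forward_diff_iterate) (auto simp: norm_mult norm_power)
    then show ?thesis using s by (simp add: abs_divide power_divide field_simps)
  qed
  have "((\<lambda>s. 2 * sin (t * s / 2) / s) \<longlongrightarrow> t) (at_right 0)"
    by real_asymp
  then have "((\<lambda>s. \<bar>2 * sin (t * s / 2) / s\<bar> ^ Suc m * ?f) \<longlongrightarrow> \<bar>t\<bar> ^ Suc m * ?f) (at_right 0)"
    by (intro tendsto_intros)
  then show ?thesis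
    by (rule tendsto_upperbound)
       (use bound in \<open>auto intro: eventually_mono[OF eventually_at_right_less[of 0]] simp del: power_Suc\<close>)
qed

lemma integrable_inverse_one_plus_square: "integrable lborel (\<lambda>x::real. 1 / (1 + x\<^sup>2))"
  using integrable_inverse_1_plus_square by (simp add: set_integrable_def einterval_def inverse_eq_divide)

section \<open>Gaussian summation, Plancherel inequality and inversion\<close>

text \<open>The multiplication formula. Fubini applies because the double integrand has modulus
  \<open>cmod (f t) * cmod (h x)\<close>.\<close>

lemma integral_fourier_mult:
  assumes f: "integrable lborel f" and h: "integrable lborel h"
  shows "(\<integral>x. fourier f x * h x \<partial>lborel) = (\<integral>t. f t * fourier h t \<partial>lborel)"
proof -
  have [measurable]: "f \<in> borel_measurable borel" "h \<in> borel_measurable borel" using f h by auto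
  have int: "integrable (lborel \<Otimes>\<^sub>M lborel) (\<lambda>(x, t). cis (x * t) * f t * h x)"
  proof (rule lborel_pair.Fubini_integrable)
    show "integrable lborel (\<lambda>x. \<integral>t. norm (case (x, t) of (x, t) \<Rightarrow> cis (x * t) * f t * h x) \<partial>lborel)"
      using h by (simp add: norm_mult)
    show "AE x in lborel. integrable lborel (\<lambda>t. case (x, t) of (x, t) \<Rightarrow> cis (x * t) * f t * h x)"
      by (auto intro!: integrable_mult_left integrable_cis_mult f)
  qed measurable
  have "(\<integral>x. fourier f x * h x \<partial>lborel) = (\<integral>x. (\<integral>t. cis (x * t) * f t * h x \<partial>lborel) \<partial>lborel)"
    unfolding fourier_def by simp
  also have "\<dots> = (\<integral>t. (\<integral>x. cis (x * t) * f t * h x \<partial>lborel) \<partial>lborel)"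
    by (rule lborel_pair.Fubini_integral[OF int, symmetric])
  also have "\<dots> = (\<integral>t. (\<integral>x. f t * (cis (t * x) * h x) \<partial>lborel) \<partial>lborel)"
    by (simp add: ac_simps)
  also have "\<dots> = (\<integral>t. f t * fourier h t \<partial>lborel)"
    unfolding fourier_def by simp
  finally show ?thesis .
qed

text \<open>A convergence factor, left unnormalised so that it lies between 0 and 1 and tends to 1
  pointwise as \<open>e\<close> tends to 0.\<close>

definition gaussian_weight :: "real \<Rightarrow> real \<Rightarrow> real" where
  "gaussian_weight e x = exp (- (e * x)\<^sup>2 / 2)"

lemma gaussian_weight_bounds: "0 \<le> gaussian_weight e x" "gaussian_weight e x \<le> 1"
  by (simp_all add: gaussian_weight_def)

lemma borel_measurable_gaussian_weight [measurable]: "gaussian_weight e \<in> borel_measurable borel"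
  unfolding gaussian_weight_def[abs_def] by measurable

lemma gaussian_weight_eq: "gaussian_weight e x = sqrt (2 * pi) * std_normal_density (e * x)"
  by (simp add: gaussian_weight_def std_normal_density_def)

lemma integrable_gaussian_weight:
  assumes "e > 0" shows "integrable lborel (gaussian_weight e)"
proof -
  have "integrable lborel (\<lambda>x. std_normal_density (0 + e * x))"
    by (rule lborel_integrable_real_affine[of std_normal_density]) (use assms in auto)
  then show ?thesis unfolding gaussian_weight_eq[abs_def] by simp
qed

lemma tendsto_gaussian_weight: "(\<lambda>n. gaussian_weight (inverse (real (Suc n))) x) \<longlonglongrightarrow> 1"
proof -
  have "(\<lambda>n. gaussian_weight (inverse (real (Suc n))) x) \<longlonglongrightarrow> exp (- (0 * x)\<^sup>2 / 2)"
    unfolding gaussian_weight_def by (intro tendsto_intros LIMSEQ_inverse_real_of_nat) simp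
  then show ?thesis by simp
qed

lemma fourier_std_normal_density:
  "fourier (\<lambda>x. complex_of_real (std_normal_density x)) t = complex_of_real (exp (- t\<^sup>2 / 2))"
proof -
  have "char std_normal_distribution t = (\<integral>x. std_normal_density x *\<^sub>R iexp (t * x) \<partial>lborel)"
    unfolding char_def by (subst integral_density) auto
  then show ?thesis
    unfolding char_std_normal_distribution fourier_def
    by (simp add: cis_conv_exp scaleR_conv_of_real mult.commute)
qed

text \<open>The right-hand side is \<open>2 * pi\<close> times the centred normal density of
  standard deviation \<open>e\<close>, an approximate identity. The proof rescales the variable in
  the transform of the standard normal density.\<close>

lemma fourier_gaussian_weight:
  assumes "e > 0"
  shows "fourier (\<lambda>x. complex_of_real (gaussian_weight e x)) t = complex_of_real (2 * pi / e * std_normal_density (t / e))"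
proof -
  have "fourier (\<lambda>x. complex_of_real (std_normal_density x)) (t / e)
      = e * (\<integral>x. cis (t * x) * complex_of_real (std_normal_density (e * x)) \<partial>lborel)"
    unfolding fourier_def using assms
    by (subst lborel_integral_real_affine[where c=e and t=0]) (auto simp: scaleR_conv_of_real)
  moreover have "fourier (\<lambda>x. complex_of_real (gaussian_weight e x)) t
     = sqrt (2 * pi) * (\<integral>x. cis (t * x) * complex_of_real (std_normal_density (e * x)) \<partial>lborel)"
    unfolding fourier_def gaussian_weight_eq
    by (subst integral_mult_right_zero[symmetric]) (simp add: mult.left_commute)
  ultimately have "fourier (\<lambda>x. complex_of_real (gaussian_weight e x)) t
     = complex_of_real (sqrt (2 * pi) / e * exp (- (t / e)\<^sup>2 / 2))"
    using assms unfolding fourier_std_normal_density by (simp add: field_simps)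
  also have "sqrt (2 * pi) / e * exp (- (t / e)\<^sup>2 / 2) = 2 * pi / e * std_normal_density (t / e)"
  proof -
    have "2 * pi / sqrt (2 * pi) = sqrt (2 * pi)" by (rule real_div_sqrt) simp
    then show ?thesis unfolding std_normal_density_def
      by (metis (no_types, lifting) mult.right_neutral times_divide_eq_left times_divide_eq_right mult.commute)
  qed
  finally show ?thesis .
qed

text \<open>Apply the multiplication formula to \<open>g\<close> and a Gaussian times a character.
  The transform of the latter is a bump of width \<open>e\<close> around \<open>t\<close>, and
  substituting \<open>s = t + e * z\<close> turns the integral into a Gaussian average of
  \<open>g\<close> near \<open>t\<close>.\<close>

lemma gaussian_summation:
  assumes g: "integrable lborel g" and e: "e > 0"
  shows "(\<integral>x. fourier g x * (complex_of_real (gaussian_weight e x) * cis (- (t * x))) \<partial>lborel)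
    = 2 * pi * (\<integral>z. g (t + e * z) * complex_of_real (std_normal_density z) \<partial>lborel)"
proof -
  have int: "integrable lborel (\<lambda>x. complex_of_real (gaussian_weight e x) * cis (- (t * x)))"
    using integrable_cis_mult[OF integrable_of_real[OF integrable_gaussian_weight[OF e]], of "- t"]
    by (simp add: mult.commute)
  have F: "fourier (\<lambda>x. complex_of_real (gaussian_weight e x) * cis (- (t * x))) s
      = complex_of_real (2 * pi / e * std_normal_density ((s - t) / e))" for s
    unfolding fourier_gaussian_weight[OF e, symmetric] unfolding fourier_def
  proof (rule Bochner_Integration.integral_cong[OF refl])
    fix x
    have "cis ((s - t) * x) = cis (s * x) * cis (- (t * x))" by (simp add: cis_mult left_diff_distrib)
    then show "cis (s * x) * (complex_of_real (gaussian_weight e x) * cis (- (t * x)))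
        = cis ((s - t) * x) * complex_of_real (gaussian_weight e x)" by simp
  qed
  have "(\<integral>x. fourier g x * (complex_of_real (gaussian_weight e x) * cis (- (t * x))) \<partial>lborel)
    = (\<integral>s. g s * complex_of_real (2 * pi / e * std_normal_density ((s - t) / e)) \<partial>lborel)"
    unfolding integral_fourier_mult[OF g int] F ..
  also have "\<dots> = e *\<^sub>R (\<integral>z. g (t + e * z) * complex_of_real (2 * pi / e * std_normal_density z) \<partial>lborel)"
    using e by (subst lborel_integral_real_affine[where c=e and t=t]) auto
  also have "(\<lambda>z. g (t + e * z) * complex_of_real (2 * pi / e * std_normal_density z))
     = (\<lambda>z. complex_of_real (2 * pi / e) * (g (t + e * z) * complex_of_real (std_normal_density z)))"
    by (simp add: fun_eq_iff)
  finally show ?thesis using e by (simp add: scaleR_conv_of_real)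
qed

text \<open>A Cauchy-Schwarz bound on the autocorrelation that also covers an infinite right-hand
  side: \<open>2 * a * b\<close> is at most the sum of the squares pointwise, and both squares have
  the same integral by translation invariance.\<close>

lemma nn_integral_mult_shift_le:
  fixes g :: "real \<Rightarrow> complex"
  assumes [measurable]: "g \<in> borel_measurable borel"
  shows "(\<integral>\<^sup>+t. ennreal (cmod (g t) * cmod (g (t + a))) \<partial>lborel) \<le> (\<integral>\<^sup>+t. ennreal ((cmod (g t))\<^sup>2) \<partial>lborel)"
    (is "_ \<le> ?N")
proof -
  have "(\<integral>\<^sup>+t. ennreal (cmod (g t) * cmod (g (t + a))) \<partial>lborel)
     \<le> (\<integral>\<^sup>+t. ennreal (1/2) * ennreal ((cmod (g t))\<^sup>2) + ennreal (1/2) * ennreal ((cmod (g (a + 1 * t)))\<^sup>2) \<partial>lborel)"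
  proof (rule nn_integral_mono)
    fix t
    have "cmod (g t) * cmod (g (t + a)) \<le> 1/2 * (cmod (g t))\<^sup>2 + 1/2 * (cmod (g (a + 1 * t)))\<^sup>2"
      using sum_squares_bound[of "cmod (g t)" "cmod (g (t + a))"] by (simp add: add.commute)
    then have "ennreal (cmod (g t) * cmod (g (t + a))) \<le> ennreal (1/2 * (cmod (g t))\<^sup>2 + 1/2 * (cmod (g (a + 1 * t)))\<^sup>2)"
      by (rule ennreal_leI)
    also have "\<dots> = ennreal (1/2) * ennreal ((cmod (g t))\<^sup>2) + ennreal (1/2) * ennreal ((cmod (g (a + 1 * t)))\<^sup>2)"
      by (subst ennreal_plus) (auto simp only: ennreal_mult' zero_le_divide_1_iff zero_le_numeral zero_le_power2 mult_nonneg_nonneg)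
    finally show "ennreal (cmod (g t) * cmod (g (t + a)))
      \<le> ennreal (1/2) * ennreal ((cmod (g t))\<^sup>2) + ennreal (1/2) * ennreal ((cmod (g (a + 1 * t)))\<^sup>2)" .
  qed
  also have "\<dots> = ennreal (1/2) * ?N + ennreal (1/2) * (\<integral>\<^sup>+t. ennreal ((cmod (g (a + 1 * t)))\<^sup>2) \<partial>lborel)"
    by (simp add: nn_integral_add nn_integral_cmult)
  also have "(\<integral>\<^sup>+t. ennreal ((cmod (g (a + 1 * t)))\<^sup>2) \<partial>lborel) = ?N"
    by (subst (2) nn_integral_real_affine[where c=1 and t=a]) auto
  also have "ennreal (1/2) * ?N + ennreal (1/2) * ?N = ?N"
  proof -
    have "ennreal (1/2) + ennreal (1/2) = 1" by (subst ennreal_plus[symmetric]) simp_all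
    then show ?thesis by (simp only: distrib_right[symmetric] mult_1)
  qed
  finally show ?thesis .
qed

lemma bounded_fourier_mult_integrable:
  assumes g: "integrable lborel g" and h: "integrable lborel h"
  shows "integrable lborel (\<lambda>x. fourier g x * h x)"
proof (rule Bochner_Integration.integrable_bound)
  have [measurable]: "g \<in> borel_measurable borel" "h \<in> borel_measurable borel" using g h by auto
  show "integrable lborel (\<lambda>x. complex_of_real (\<integral>x. cmod (g x) \<partial>lborel) * h x)" using h by auto
  show "(\<lambda>x. fourier g x * h x) \<in> borel_measurable lborel" by measurable
  show "AE x in lborel. norm (fourier g x * h x) \<le> norm (complex_of_real (\<integral>x. cmod (g x) \<partial>lborel) * h x)"
    using norm_fourier_le[of g] by (auto simp: norm_mult intro!: mult_right_mono)
qed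

text \<open>
  Applying the Gaussian summation formula to \<open>\<bar>fourier g\<bar>\<^sup>2 = fourier g \<cdot> cnj (fourier g)\<close> turns the
  left-hand side into \<open>2 \<pi>\<close> times an average over z of the autocorrelations of g at lag e z.
\<close>

lemma nn_integral_fourier_gaussian_le:
  assumes g: "integrable lborel g" and e: "e > 0"
  shows "(\<integral>\<^sup>+x. ennreal ((cmod (fourier g x))\<^sup>2 * gaussian_weight e x) \<partial>lborel)
    \<le> ennreal (2 * pi) * (\<integral>\<^sup>+t. ennreal ((cmod (g t))\<^sup>2) \<partial>lborel)"
proof -
  have [measurable]: "g \<in> borel_measurable borel" using g by auto
  define w where "w x = complex_of_real (gaussian_weight e x)" for x
  have w: "integrable lborel w" unfolding w_def by (intro integrable_of_real integrable_gaussian_weight e)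
  then have [measurable]: "w \<in> borel_measurable borel" by auto
  \<comment> \<open>The conjugate makes \<open>fourier g x * h x\<close> the weighted squared
    modulus, while the transform of \<open>h\<close> is a conjugated Gaussian average of
    \<open>g\<close>.\<close>
  define h where "h x = cnj (fourier g x) * w x" for x
  have gw: "integrable lborel (\<lambda>x. fourier g x * w x)" by (rule bounded_fourier_mult_integrable[OF g w])
  have hw: "h = (\<lambda>x. cnj (fourier g x * w x))" by (simp add: h_def w_def fun_eq_iff)
  have h: "integrable lborel h" unfolding hw using gw by (simp del: complex_cnj_mult)
  define S where "S t = (\<integral>z. g (t + e * z) * complex_of_real (std_normal_density z) \<partial>lborel)" for t
  have [measurable]: "S \<in> borel_measurable borel" unfolding S_def[abs_def] by measurable
  have Fh: "fourier h t = 2 * pi * cnj (S t)" for t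
  proof -
    have "fourier h t = (\<integral>x. cnj (fourier g x * (w x * cis (- (t * x)))) \<partial>lborel)"
      unfolding fourier_def[of h] unfolding hw
      by (rule Bochner_Integration.integral_cong) (auto simp: cis_cnj[symmetric])
    also have "\<dots> = cnj (\<integral>x. fourier g x * (w x * cis (- (t * x))) \<partial>lborel)" by (rule Bochner_Integration.integral_cnj)
    also have "\<dots> = 2 * pi * cnj (S t)" unfolding w_def gaussian_summation[OF g e] S_def by simp
    finally show ?thesis .
  qed
  have eq: "fourier g x * h x = complex_of_real ((cmod (fourier g x))\<^sup>2 * gaussian_weight e x)" for x
    unfolding of_real_mult complex_norm_square by (simp add: h_def w_def)
  have int: "integrable lborel (\<lambda>x. complex_of_real ((cmod (fourier g x))\<^sup>2 * gaussian_weight e x))"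
    using bounded_fourier_mult_integrable[OF g h] unfolding eq .
  have intR: "integrable lborel (\<lambda>x. (cmod (fourier g x))\<^sup>2 * gaussian_weight e x)"
    using integrable_Re[OF int] by (simp only: Re_complex_of_real)
  have "complex_of_real (\<integral>x. (cmod (fourier g x))\<^sup>2 * gaussian_weight e x \<partial>lborel) = (\<integral>t. g t * (2 * pi * cnj (S t)) \<partial>lborel)"
    using integral_fourier_mult[OF g h] unfolding eq Fh integral_complex_of_real .
  \<comment> \<open>The left-hand side is a nonnegative real, so it equals the modulus of the
    right-hand side.\<close>
  then have "(\<integral>x. (cmod (fourier g x))\<^sup>2 * gaussian_weight e x \<partial>lborel) = cmod (\<integral>t. g t * (2 * pi * cnj (S t)) \<partial>lborel)"
  proof -
    assume *: "complex_of_real (\<integral>x. (cmod (fourier g x))\<^sup>2 * gaussian_weight e x \<partial>lborel) = (\<integral>t. g t * (2 * pi * cnj (S t)) \<partial>lborel)"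
    have "0 \<le> (\<integral>x. (cmod (fourier g x))\<^sup>2 * gaussian_weight e x \<partial>lborel)"
      by (intro integral_nonneg_AE AE_I2 mult_nonneg_nonneg gaussian_weight_bounds) simp
    then show ?thesis unfolding *[symmetric] by (simp only: norm_of_real abs_of_nonneg)
  qed
  then have "(\<integral>\<^sup>+x. ennreal ((cmod (fourier g x))\<^sup>2 * gaussian_weight e x) \<partial>lborel)
      = ennreal (cmod (\<integral>t. g t * (2 * pi * cnj (S t)) \<partial>lborel))"
    using nn_integral_eq_integral[OF intR] by (simp add: gaussian_weight_bounds)
  \<comment> \<open>A Bochner integral is 0 when its integrand is not integrable, so the bound by
    the integral of the modulus holds in either case. The same split is used for \<open>S\<close>
    below.\<close>
  also have "\<dots> \<le> (\<integral>\<^sup>+t. ennreal (cmod (g t * (2 * pi * cnj (S t)))) \<partial>lborel)"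
  proof (cases "integrable lborel (\<lambda>t. g t * (2 * pi * cnj (S t)))")
    case True
    then show ?thesis using integral_norm_bound_ennreal by blast
  next
    case False
    then show ?thesis by (simp add: not_integrable_integral_eq)
  qed
  also have "\<dots> = ennreal (2 * pi) * (\<integral>\<^sup>+t. ennreal (cmod (g t)) * ennreal (cmod (S t)) \<partial>lborel)"
  proof -
    have "cmod (g t * (2 * pi * cnj (S t))) = 2 * pi * (cmod (g t) * cmod (S t))" for t
      by (simp add: norm_mult)
    then have "ennreal (cmod (g t * (2 * pi * cnj (S t)))) = ennreal (2 * pi) * (ennreal (cmod (g t)) * ennreal (cmod (S t)))" for t
      by (simp only: ennreal_mult' norm_ge_zero mult_nonneg_nonneg pi_ge_zero zero_le_numeral)
    then show ?thesis by (simp only:) (rule nn_integral_cmult, measurable)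
  qed
  also have "\<dots> \<le> ennreal (2 * pi) * (\<integral>\<^sup>+t. ennreal (cmod (g t)) * (\<integral>\<^sup>+z. ennreal (cmod (g (t + e * z)) * std_normal_density z) \<partial>lborel) \<partial>lborel)"
  proof (intro mult_left_mono nn_integral_mono)
    fix t
    show "ennreal (cmod (S t)) \<le> (\<integral>\<^sup>+z. ennreal (cmod (g (t + e * z)) * std_normal_density z) \<partial>lborel)"
    proof (cases "integrable lborel (\<lambda>z. g (t + e * z) * complex_of_real (std_normal_density z))")
      case True
      from integral_norm_bound_ennreal[OF this] show ?thesis unfolding S_def by (simp add: norm_mult)
    next
      case False
      then show ?thesis unfolding S_def by (simp add: not_integrable_integral_eq)
    qed
  qed auto
  also have "(\<integral>\<^sup>+t. ennreal (cmod (g t)) * (\<integral>\<^sup>+z. ennreal (cmod (g (t + e * z)) * std_normal_density z) \<partial>lborel) \<partial>lborel)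
     = (\<integral>\<^sup>+t. (\<integral>\<^sup>+z. ennreal (std_normal_density z) * ennreal (cmod (g t) * cmod (g (t + e * z))) \<partial>lborel) \<partial>lborel)"
    by (subst nn_integral_cmult[symmetric]) (auto simp: ennreal_mult mult_ac intro!: nn_integral_cong)
  \<comment> \<open>After this exchange the inner integral is the autocorrelation at lag
    \<open>e * z\<close>; the remaining integral of the normal density over \<open>z\<close> is
    1.\<close>
  also have "\<dots> = (\<integral>\<^sup>+z. (\<integral>\<^sup>+t. ennreal (std_normal_density z) * ennreal (cmod (g t) * cmod (g (t + e * z))) \<partial>lborel) \<partial>lborel)"
    by (rule lborel_pair.Fubini') measurable
  also have "\<dots> = (\<integral>\<^sup>+z. ennreal (std_normal_density z) * (\<integral>\<^sup>+t. ennreal (cmod (g t) * cmod (g (t + e * z))) \<partial>lborel) \<partial>lborel)"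
    by (intro nn_integral_cong nn_integral_cmult) measurable
  also have "\<dots> \<le> (\<integral>\<^sup>+z. ennreal (std_normal_density z) * (\<integral>\<^sup>+t. ennreal ((cmod (g t))\<^sup>2) \<partial>lborel) \<partial>lborel)"
    by (intro nn_integral_mono mult_left_mono nn_integral_mult_shift_le) auto
  also have "\<dots> = (\<integral>\<^sup>+t. ennreal ((cmod (g t))\<^sup>2) \<partial>lborel)"
    by (simp add: nn_integral_multc nn_integral_eq_integral)
  finally show ?thesis by (simp add: mult_left_mono)
qed

text \<open>Fatou's lemma applied to the Gaussian-weighted bound as the weight tends to 1; the bound
  does not depend on the weight.\<close>

lemma plancherel_le:
  assumes g: "integrable lborel g"
  shows "(\<integral>\<^sup>+x. ennreal ((cmod (fourier g x))\<^sup>2) \<partial>lborel)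
    \<le> ennreal (2 * pi) * (\<integral>\<^sup>+t. ennreal ((cmod (g t))\<^sup>2) \<partial>lborel)"
proof -
  have [measurable]: "g \<in> borel_measurable borel" using g by auto
  let ?F = "\<lambda>n x. ennreal ((cmod (fourier g x))\<^sup>2 * gaussian_weight (inverse (real (Suc n))) x)"
  have "ennreal ((cmod (fourier g x))\<^sup>2) = liminf (\<lambda>n. ?F n x)" for x
  proof -
    have "(\<lambda>n. ?F n x) \<longlonglongrightarrow> ennreal ((cmod (fourier g x))\<^sup>2 * 1)"
      by (intro tendsto_ennrealI tendsto_mult tendsto_const tendsto_gaussian_weight)
    then show ?thesis by (simp add: lim_imp_Liminf)
  qed
  then have "(\<integral>\<^sup>+x. ennreal ((cmod (fourier g x))\<^sup>2) \<partial>lborel) = (\<integral>\<^sup>+x. liminf (\<lambda>n. ?F n x) \<partial>lborel)"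
    by simp
  also have "\<dots> \<le> liminf (\<lambda>n. \<integral>\<^sup>+x. ?F n x \<partial>lborel)"
    by (rule nn_integral_liminf) measurable
  also have "\<dots> \<le> ennreal (2 * pi) * (\<integral>\<^sup>+t. ennreal ((cmod (g t))\<^sup>2) \<partial>lborel)"
  proof -
    let ?B = "ennreal (2 * pi) * (\<integral>\<^sup>+t. ennreal ((cmod (g t))\<^sup>2) \<partial>lborel)"
    have "liminf (\<lambda>n. \<integral>\<^sup>+x. ?F n x \<partial>lborel) \<le> liminf (\<lambda>n. ?B)"
      by (intro Liminf_mono always_eventually allI nn_integral_fourier_gaussian_le g) simp
    then show ?thesis by (simp add: Liminf_const)
  qed
  finally show ?thesis .
qed

section \<open>Pointwise Fourier inversion for a continuous nonnegative function\<close>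

lemma std_normal_density_le_1: "std_normal_density z \<le> 1"
proof -
  have "1 \<le> sqrt (2 * pi)" using pi_ge_two by (simp add: real_le_rsqrt)
  then have "1 / sqrt (2 * pi) * exp (- z\<^sup>2 / 2) \<le> 1 * 1"
    by (intro mult_mono) auto
  then show ?thesis by (simp add: std_normal_density_def)
qed

text \<open>Gaussian summation equates a damped inversion integral with \<open>2 * pi\<close> times
  a Gaussian average of \<open>p\<close>. As the damping vanishes, the former tends to the inversion
  integral because the transform is integrable, and the latter to \<open>2 * pi * p x\<close> by
  continuity.\<close>

lemma fourier_inversion:
  fixes p :: "real \<Rightarrow> real"
  assumes p: "integrable lborel p" and cont: "continuous_on UNIV p" and nonneg: "\<And>x. 0 \<le> p x"
    and f: "integrable lborel (fourier (\<lambda>x. complex_of_real (p x)))"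
  shows "complex_of_real (p x) = fourier (fourier (\<lambda>x. complex_of_real (p x))) (- x) / (2 * pi)"
proof -
  let ?f = "fourier (\<lambda>x. complex_of_real (p x))"
  have [measurable]: "p \<in> borel_measurable borel" using p by auto
  define e where "e n = inverse (real (Suc n))" for n
  have e: "e n > 0" for n by (simp add: e_def)
  have e_lim: "e \<longlonglongrightarrow> 0" unfolding e_def by (rule LIMSEQ_inverse_real_of_nat)
  define G where "G n y z = p (y + e n * z) * std_normal_density z" for n y z
  have [measurable]: "G n y \<in> borel_measurable borel" for n y
    unfolding G_def[abs_def] by measurable
  have intG: "integrable lborel (G n y)" for n y
  proof (rule Bochner_Integration.integrable_bound)
    show "integrable lborel (\<lambda>z. p (y + e n * z))"
      using lborel_integrable_real_affine[OF p] e[of n] by auto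
    show "AE z in lborel. norm (G n y z) \<le> norm (p (y + e n * z))"
      using nonneg std_normal_density_le_1 by (auto simp: G_def abs_mult intro!: mult_left_le)
  qed simp
  define L where "L n y = (\<integral>t. ?f t * (complex_of_real (gaussian_weight (e n) t) * cis (- (y * t))) \<partial>lborel)" for n y
  have L_eq: "L n y = 2 * pi * complex_of_real (integral\<^sup>L lborel (G n y))" for n y
  proof -
    have "L n y = 2 * pi * (\<integral>z. complex_of_real (G n y z) \<partial>lborel)"
      unfolding L_def using gaussian_summation[OF integrable_of_real[OF p] e] by (simp add: G_def)
    then show ?thesis by (simp only: integral_complex_of_real)
  qed
  have G_lim: "(\<lambda>n. G n y z) \<longlonglongrightarrow> p y * std_normal_density z" for y z
  proof -
    have "(\<lambda>n. y + e n * z) \<longlonglongrightarrow> y + 0 * z" by (intro tendsto_intros e_lim)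
    then have "(\<lambda>n. p (y + e n * z)) \<longlonglongrightarrow> p y"
      using cont by (intro isCont_tendsto_compose[of y p]) (auto simp: continuous_on_eq_continuous_at)
    then show ?thesis unfolding G_def by (intro tendsto_intros)
  qed
  define C where "C = (\<integral>t. cmod (?f t) \<partial>lborel)"
  \<comment> \<open>The damped inversion integral \<open>L n y\<close> is bounded by the L1 norm of
    the transform, uniformly in \<open>n\<close> and \<open>y\<close>; by nonnegativity of
    \<open>p\<close> this controls the averages of \<open>p\<close>.\<close>
  have G_le: "2 * pi * integral\<^sup>L lborel (G n y) \<le> C" for n y
  proof -
    have "2 * pi * integral\<^sup>L lborel (G n y) \<le> cmod (L n y)"
      unfolding L_eq by (simp add: norm_mult mult_left_mono)
    also have "\<dots> \<le> (\<integral>t. cmod (?f t * (complex_of_real (gaussian_weight (e n) t) * cis (- (y * t)))) \<partial>lborel)"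
      unfolding L_def by (rule integral_norm_bound)
    also have "\<dots> \<le> C"
      unfolding C_def using f
      by (intro integral_mono') (auto simp: norm_mult abs_of_nonneg gaussian_weight_bounds intro!: mult_left_le)
    finally show ?thesis .
  qed
  \<comment> \<open>Fatou's lemma bounds p, which then supplies the dominating function below.\<close>
  have bounded: "p y \<le> C / (2 * pi)" for y
  proof -
    have "ennreal (p y) = (\<integral>\<^sup>+z. ennreal (p y * std_normal_density z) \<partial>lborel)"
      using nonneg by (simp add: ennreal_mult nn_integral_cmult nn_integral_eq_integral)
    also have "\<dots> = (\<integral>\<^sup>+z. liminf (\<lambda>n. ennreal (G n y z)) \<partial>lborel)"
      by (intro nn_integral_cong lim_imp_Liminf[symmetric] tendsto_ennrealI G_lim) simp
    also have "\<dots> \<le> liminf (\<lambda>n. \<integral>\<^sup>+z. ennreal (G n y z) \<partial>lborel)"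
      by (rule nn_integral_liminf) (simp add: G_def)
    also have "\<dots> \<le> liminf (\<lambda>n. ennreal (C / (2 * pi)))"
    proof (intro Liminf_mono always_eventually allI)
      fix n
      have "(\<integral>\<^sup>+z. ennreal (G n y z) \<partial>lborel) = ennreal (integral\<^sup>L lborel (G n y))"
        using nonneg by (intro nn_integral_eq_integral intG) (auto simp: G_def)
      also have "\<dots> \<le> ennreal (C / (2 * pi))"
        using G_le[of n y] by (intro ennreal_leI) (simp add: field_simps)
      finally show "(\<integral>\<^sup>+z. ennreal (G n y z) \<partial>lborel) \<le> ennreal (C / (2 * pi))" .
    qed
    also have "\<dots> = ennreal (C / (2 * pi))" by (simp add: Liminf_const)
    finally show ?thesis by (subst (asm) ennreal_le_iff) (auto simp: C_def)
  qed
  have "(\<lambda>n. integral\<^sup>L lborel (G n x)) \<longlonglongrightarrow> (\<integral>z. p x * std_normal_density z \<partial>lborel)"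
  proof (rule integral_dominated_convergence)
    show "integrable lborel (\<lambda>z. C / (2 * pi) * std_normal_density z)" by simp
    show "AE z in lborel. norm (G n x z) \<le> C / (2 * pi) * std_normal_density z" for n
    proof (rule AE_I2)
      fix z
      have "norm (G n x z) = p (x + e n * z) * std_normal_density z"
        using nonneg by (simp add: G_def abs_mult)
      also have "\<dots> \<le> C / (2 * pi) * std_normal_density z"
        by (intro mult_right_mono bounded) simp
      finally show "norm (G n x z) \<le> C / (2 * pi) * std_normal_density z" .
    qed
    show "AE z in lborel. (\<lambda>n. G n x z) \<longlonglongrightarrow> p x * std_normal_density z"
      by (intro AE_I2 G_lim)
  qed simp_all
  then have "(\<lambda>n. L n x) \<longlonglongrightarrow> 2 * pi * complex_of_real (p x)"
    unfolding L_eq by (intro tendsto_intros) simp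
  moreover have "(\<lambda>n. L n x) \<longlonglongrightarrow> (\<integral>t. ?f t * (complex_of_real 1 * cis (- (x * t))) \<partial>lborel)"
    unfolding L_def
  proof (rule integral_dominated_convergence)
    show "integrable lborel (\<lambda>t. cmod (?f t))" using f by simp
    show "AE t in lborel. (\<lambda>n. ?f t * (complex_of_real (gaussian_weight (e n) t) * cis (- (x * t))))
        \<longlonglongrightarrow> ?f t * (complex_of_real 1 * cis (- (x * t)))"
      unfolding e_def by (intro AE_I2 tendsto_intros tendsto_gaussian_weight)
    show "AE t in lborel. cmod (?f t * (complex_of_real (gaussian_weight (e n) t) * cis (- (x * t)))) \<le> cmod (?f t)" for n
      by (auto simp: norm_mult abs_of_nonneg gaussian_weight_bounds intro!: mult_left_le)
  qed measurable
  moreover have "(\<integral>t. ?f t * (complex_of_real 1 * cis (- (x * t))) \<partial>lborel) = fourier ?f (- x)"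
    unfolding fourier_def[of ?f] by (simp add: mult.commute)
  ultimately have "2 * pi * complex_of_real (p x) = fourier ?f (- x)"
    using LIMSEQ_unique by metis
  then show ?thesis by (simp add: field_simps)
qed

text \<open>For nonzero \<open>x\<close> an antiderivative is
  \<open>cis (t * x) / (\<i> * x)\<close>. At \<open>x = 0\<close> the value is the length of the
  interval, matching \<open>sinc 0 = 1\<close>.\<close>

lemma fourier_indicator_interval:
  assumes "T > 0"
  shows "fourier (\<lambda>t. complex_of_real (indicator {-T..T} t)) x = complex_of_real (2 * T * sinc (T * x))"
proof (cases "x = 0")
  case True
  then show ?thesis using assms by (simp add: fourier_def)
next
  case False
  have ii: "- (\<i> * (z * \<i>)) = z" for z by (simp add: complex_eq_iff)
  have "((\<lambda>t. cis (t * x)) has_integral (cis (T * x) / (\<i> * x) - cis (- T * x) / (\<i> * x))) {-T..T}"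
    using assms False
    by (intro fundamental_theorem_of_calculus)
       (auto simp: cis_conv_exp ii intro!: derivative_eq_intros has_vector_derivative_real_field)
  moreover have si: "set_integrable lborel {-T..T} (\<lambda>t. cis (t * x))"
    by (intro borel_integrable_atLeastAtMost') (auto intro!: continuous_intros)
  ultimately have "(CLINT t:{-T..T}|lborel. cis (t * x)) = cis (T * x) / (\<i> * x) - cis (- T * x) / (\<i> * x)"
    using set_borel_integral_eq_integral(2)[OF si] by (simp add: integral_unique)
  also have "\<dots> = complex_of_real (2 * T * sinc (T * x))"
  proof -
    have "cis (T * x) - cis (- T * x) = \<i> * complex_of_real (2 * sin (T * x))"
      by (simp add: complex_eq_iff)
    then show ?thesis using False assms by (simp flip: diff_divide_distrib)
  qed
  finally show ?thesis
    by (simp add: fourier_def set_lebesgue_integral_def scaleR_conv_of_real mult.commute)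
qed

section \<open>Variance and bias of the sinc estimator\<close>

text \<open>Additivity of the variance for complex variables: expand the squared modulus as a double
  sum of \<open>Y j * cnj (Y k)\<close>; independence and zero means kill the terms off the
  diagonal.\<close>

lemma (in prob_space) indep_vars_norm_sum_square:
  fixes Y :: "'i \<Rightarrow> 'a \<Rightarrow> complex"
  assumes J: "finite J" and indep: "indep_vars (\<lambda>_. borel) Y J"
    and int: "\<And>j. j \<in> J \<Longrightarrow> integrable M (Y j)"
    and int2: "\<And>j. j \<in> J \<Longrightarrow> integrable M (\<lambda>\<omega>. (cmod (Y j \<omega>))\<^sup>2)"
    and mean: "\<And>j. j \<in> J \<Longrightarrow> (\<integral>\<omega>. Y j \<omega> \<partial>M) = 0"
  shows "integrable M (\<lambda>\<omega>. (cmod (\<Sum>j\<in>J. Y j \<omega>))\<^sup>2)"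
    and "(\<integral>\<omega>. (cmod (\<Sum>j\<in>J. Y j \<omega>))\<^sup>2 \<partial>M) = (\<Sum>j\<in>J. \<integral>\<omega>. (cmod (Y j \<omega>))\<^sup>2 \<partial>M)"
proof -
  define E where "E j = (\<integral>\<omega>. (cmod (Y j \<omega>))\<^sup>2 \<partial>M)" for j
  have cross: "integrable M (\<lambda>\<omega>. Y j \<omega> * cnj (Y k \<omega>)) \<and>
      (\<integral>\<omega>. Y j \<omega> * cnj (Y k \<omega>) \<partial>M) = (if j = k then complex_of_real (E j) else 0)"
    if jk: "j \<in> J" "k \<in> J" for j k
  proof (cases "j = k")
    case True
    have "integrable M (\<lambda>\<omega>. complex_of_real ((cmod (Y k \<omega>))\<^sup>2))"
      using int2[OF jk(2)] by (rule integrable_of_real)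
    moreover have "(\<integral>\<omega>. complex_of_real ((cmod (Y k \<omega>))\<^sup>2) \<partial>M) = complex_of_real (E k)"
      unfolding E_def by (rule integral_complex_of_real)
    ultimately show ?thesis using True
      unfolding complex_norm_square by simp
  next
    case False
    \<comment> \<open>Only the factor with index \<open>k\<close> is conjugated, so the product over
      \<open>{j, k}\<close> is the mixed term; conjugation is continuous, hence independence
      survives.\<close>
    define Z where "Z i = (if i = k then (\<lambda>\<omega>. cnj (Y i \<omega>)) else Y i)" for i
    have "indep_vars (\<lambda>_. borel) (\<lambda>i \<omega>. (if i = k then cnj else id) (Y i \<omega>)) {j, k}"
      using jk by (intro indep_vars_compose2[OF indep_vars_subset[OF indep]])
        (auto simp: id_def intro!: borel_measurable_continuous_onI continuous_intros)
    also have "(\<lambda>i \<omega>. (if i = k then cnj else id) (Y i \<omega>)) = Z"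
      by (auto simp: Z_def fun_eq_iff)
    finally have indep_Z: "indep_vars (\<lambda>_. borel) Z {j, k}" .
    have int_Z: "integrable M (Z i)" if "i \<in> {j, k}" for i
      using that jk int by (auto simp: Z_def)
    have "integrable M (\<lambda>\<omega>. \<Prod>i\<in>{j, k}. Z i \<omega>)"
      by (rule indep_vars_integrable[OF _ indep_Z int_Z]) auto
    moreover have "(\<integral>\<omega>. (\<Prod>i\<in>{j, k}. Z i \<omega>) \<partial>M) = (\<Prod>i\<in>{j, k}. \<integral>\<omega>. Z i \<omega> \<partial>M)"
      by (rule indep_vars_lebesgue_integral[OF _ indep_Z int_Z]) auto
    ultimately show ?thesis using False mean[OF jk(1)] by (simp add: Z_def)
  qed
  have eq: "complex_of_real ((cmod (\<Sum>j\<in>J. Y j \<omega>))\<^sup>2) = (\<Sum>j\<in>J. \<Sum>k\<in>J. Y j \<omega> * cnj (Y k \<omega>))" for \<omega>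
    unfolding complex_norm_square cnj_sum by (rule sum_product)
  have intC: "integrable M (\<lambda>\<omega>. complex_of_real ((cmod (\<Sum>j\<in>J. Y j \<omega>))\<^sup>2))"
    unfolding eq using cross by (intro Bochner_Integration.integrable_sum) auto
  show "integrable M (\<lambda>\<omega>. (cmod (\<Sum>j\<in>J. Y j \<omega>))\<^sup>2)"
    using integrable_Re[OF intC] by (simp only: Re_complex_of_real)
  have "complex_of_real (\<integral>\<omega>. (cmod (\<Sum>j\<in>J. Y j \<omega>))\<^sup>2 \<partial>M) = (\<integral>\<omega>. (\<Sum>j\<in>J. \<Sum>k\<in>J. Y j \<omega> * cnj (Y k \<omega>)) \<partial>M)"
    unfolding eq[symmetric] integral_complex_of_real ..
  also have "\<dots> = (\<Sum>j\<in>J. \<Sum>k\<in>J. if j = k then complex_of_real (E j) else 0)"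
    using cross by (subst Bochner_Integration.integral_sum | intro sum.cong refl Bochner_Integration.integrable_sum)+ auto
  also have "\<dots> = complex_of_real (\<Sum>j\<in>J. E j)"
    using J by simp
  finally show "(\<integral>\<omega>. (cmod (\<Sum>j\<in>J. Y j \<omega>))\<^sup>2 \<partial>M) = (\<Sum>j\<in>J. \<integral>\<omega>. (cmod (Y j \<omega>))\<^sup>2 \<partial>M)"
    unfolding E_def of_real_eq_iff .
qed

section \<open>Tail integrals under polynomial decay\<close>

text \<open>The right half-line is evaluated by an explicit antiderivative vanishing at infinity,
  the left one by reflection.\<close>

lemma nn_integral_even_power_tail:
  fixes c :: real
  assumes c: "c > 0"
  shows "(\<integral>\<^sup>+t. ennreal (1 / t ^ (2 * m + 2)) * indicator (- {-c..c}) t \<partial>lborel)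
    \<le> ennreal (2 / (real (2 * m + 1) * c ^ (2 * m + 1)))"
proof -
  let ?f = "\<lambda>t::real. 1 / t ^ (2 * m + 2)"
  let ?F = "\<lambda>t::real. - (1 / (real (2 * m + 1) * t ^ (2 * m + 1)))"
  have half: "(\<integral>\<^sup>+t. ennreal (?f t) * indicator {c..} t \<partial>lborel) = ennreal (0 - ?F c)"
  proof (rule nn_integral_FTC_atLeast)
    fix x assume "c \<le> x"
    then have x: "x > 0" using c by simp
    show "0 \<le> ?f x" using x by simp
    define k and r where "k = 2 * m" and "r = real (Suc k)"
    have d: "((\<lambda>x. x ^ Suc k) has_real_derivative (r * x ^ k)) (at x)"
      by (rule DERIV_cong[OF DERIV_pow]) (simp add: r_def)
    have "r \<noteq> 0" "x ^ k \<noteq> 0" using x by (auto simp: r_def)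
    then have "((\<lambda>x. - (1 / (r * x ^ Suc k))) has_real_derivative 1 / x ^ (k + 2)) (at x)"
      using x by (intro DERIV_cong[OF DERIV_minus[OF DERIV_divide[OF DERIV_const DERIV_cmult[OF d]]]])
        (auto simp: field_simps)
    then show "(?F has_real_derivative ?f x) (at x)" by (simp add: r_def k_def)
  next
    have "filterlim (\<lambda>t::real. t ^ (2 * m + 1)) at_top at_top"
      by (rule filterlim_pow_at_top[OF _ filterlim_ident]) simp
    then have "filterlim (\<lambda>t::real. real (2 * m + 1) * t ^ (2 * m + 1)) at_top at_top"
      by (intro filterlim_tendsto_pos_mult_at_top[OF tendsto_const]) auto
    then have "((\<lambda>t. 1 / (real (2 * m + 1) * t ^ (2 * m + 1))) \<longlongrightarrow> 0) at_top"
      by (intro real_tendsto_divide_at_top[OF tendsto_const])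
    then have "(?F \<longlongrightarrow> - 0) at_top" by (rule tendsto_minus)
    then show "(?F \<longlongrightarrow> 0) at_top" by simp
  qed measurable
  \<comment> \<open>The form \<open>0 + (-1) * t\<close> is the one produced by
    \<open>nn_integral_real_affine\<close>, which performs the reflection.\<close>
  have "(\<integral>\<^sup>+t. ennreal (?f t) * indicator (- {-c..c}) t \<partial>lborel)
     \<le> (\<integral>\<^sup>+t. ennreal (?f t) * indicator {c..} t + ennreal (?f (0 + (-1) * t)) * indicator {c..} (0 + (-1) * t) \<partial>lborel)"
    by (intro nn_integral_mono) (auto simp: indicator_def)
  also have "\<dots> = (\<integral>\<^sup>+t. ennreal (?f t) * indicator {c..} t \<partial>lborel)
      + (\<integral>\<^sup>+t. ennreal (?f (0 + (-1) * t)) * indicator {c..} (0 + (-1) * t) \<partial>lborel)"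
    by (rule nn_integral_add) measurable
  also have "(\<integral>\<^sup>+t. ennreal (?f (0 + (-1) * t)) * indicator {c..} (0 + (-1) * t) \<partial>lborel)
      = (\<integral>\<^sup>+t. ennreal (?f t) * indicator {c..} t \<partial>lborel)"
    by (subst (2) nn_integral_real_affine[where c="-1" and t=0]) auto
  also have "(\<integral>\<^sup>+t. ennreal (?f t) * indicator {c..} t \<partial>lborel) + (\<integral>\<^sup>+t. ennreal (?f t) * indicator {c..} t \<partial>lborel)
     = ennreal (2 / (real (2 * m + 1) * c ^ (2 * m + 1)))"
    unfolding half using c by (subst ennreal_plus[symmetric]) auto
  finally show ?thesis .
qed

text \<open>With \<open>a ^ Suc m = V\<close>, the function is at most 1 and at most
  \<open>(a / \<bar>t\<bar>) ^ Suc m\<close>, and the two bounds cross at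
  \<open>\<bar>t\<bar> = a\<close>. Whether the cutoff \<open>T\<close> lies beyond \<open>a\<close>
  decides if the second bound alone suffices; one constant serves both cases.\<close>

lemma nn_integral_square_tail_le:
  fixes \<phi> :: "real \<Rightarrow> real" and V T :: real
  assumes [measurable]: "\<phi> \<in> borel_measurable borel"
    and \<phi>: "\<And>t. 0 \<le> \<phi> t" "\<And>t. \<phi> t \<le> 1" "\<And>t. \<bar>t\<bar> ^ Suc m * \<phi> t \<le> V"
    and V: "0 \<le> V" and T: "T > 0"
  shows "(\<integral>\<^sup>+t. ennreal ((\<phi> t)\<^sup>2) * indicator (- {-T..T}) t \<partial>lborel)
    \<le> ennreal (4 * (real m + 1) / (2 * real m + 1) * V powr ((2 * real m + 1) / (real m + 1)) * (1 / T) ^ (2 * m))"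
proof -
  define a where "a = V powr (1 / (real m + 1))"
  have a: "0 \<le> a" by (simp add: a_def)
  have a_power: "a ^ Suc k = V powr (real (Suc k) / (real m + 1))" for k
  \<comment> \<open>Turning \<open>powr\<close> into an ordinary power needs a positive base, so
    \<open>V = 0\<close> is treated apart.\<close>
  proof (cases "V = 0")
    case False
    then have "a ^ Suc k = a powr real (Suc k)" by (intro powr_realpow[symmetric]) (simp add: a_def)
    then show ?thesis unfolding a_def by (simp only: powr_powr) simp
  qed (simp add: a_def)
  have aV: "a ^ Suc m = V" unfolding a_power using V by (simp add: add.commute)
  have aP: "V powr ((2 * real m + 1) / (real m + 1)) = a ^ (2 * m + 1)"
    using a_power[of "2 * m"] by (simp add: add.commute)
  have V2: "V\<^sup>2 = a ^ (2 * m + 2)"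
    unfolding aV[symmetric] power_mult[symmetric] by (simp add: mult.commute)
  have sq: "(\<phi> t)\<^sup>2 \<le> V\<^sup>2 * (1 / t ^ (2 * m + 2))" if "t \<noteq> 0" for t
  proof -
    have "(\<bar>t\<bar> ^ Suc m * \<phi> t)\<^sup>2 \<le> V\<^sup>2" using \<phi> by (intro power_mono) auto
    moreover have "(\<bar>t\<bar> ^ Suc m)\<^sup>2 = t ^ (2 * m + 2)"
      by (metis (no_types, lifting) add_2_eq_Suc' mult.commute mult_Suc_right power_abs power_even_abs even_add even_mult_iff even_numeral power_mult add.commute)
    moreover have "0 < t ^ (2 * m + 2)" using that by (simp only: zero_less_power_eq) simp
    ultimately show ?thesis
      by (simp only: power_mult_distrib times_divide_eq_right mult_1_right pos_le_divide_eq mult.commute)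
  qed
  have tail: "(\<integral>\<^sup>+t. ennreal ((\<phi> t)\<^sup>2) * indicator (- {-c..c}) t \<partial>lborel)
      \<le> ennreal (2 * V\<^sup>2 / (real (2 * m + 1) * c ^ (2 * m + 1)))" if c: "c > 0" for c
  proof -
    have "(\<integral>\<^sup>+t. ennreal ((\<phi> t)\<^sup>2) * indicator (- {-c..c}) t \<partial>lborel)
      \<le> (\<integral>\<^sup>+t. ennreal (V\<^sup>2) * (ennreal (1 / t ^ (2 * m + 2)) * indicator (- {-c..c}) t) \<partial>lborel)"
    proof (intro nn_integral_mono)
      fix t
      show "ennreal ((\<phi> t)\<^sup>2) * indicator (- {-c..c}) t \<le> ennreal (V\<^sup>2) * (ennreal (1 / t ^ (2 * m + 2)) * indicator (- {-c..c}) t)"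
      proof (cases "t \<in> {-c..c}")
        case False
        then have "t \<noteq> 0" using c by auto
        with ennreal_leI[OF sq[OF this]] False show ?thesis
          by (simp add: ennreal_mult'[symmetric] del: power_Suc)
      qed simp
    qed
    also have "\<dots> \<le> ennreal (V\<^sup>2) * ennreal (2 / (real (2 * m + 1) * c ^ (2 * m + 1)))"
    proof (subst nn_integral_cmult)
      show "ennreal (V\<^sup>2) * (\<integral>\<^sup>+t. ennreal (1 / t ^ (2 * m + 2)) * indicator (- {-c..c}) t \<partial>lborel)
        \<le> ennreal (V\<^sup>2) * ennreal (2 / (real (2 * m + 1) * c ^ (2 * m + 1)))"
        by (rule mult_left_mono[OF nn_integral_even_power_tail[OF c]]) simp
    qed measurable
    also have "\<dots> = ennreal (2 * V\<^sup>2 / (real (2 * m + 1) * c ^ (2 * m + 1)))"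
      by (subst ennreal_mult'[symmetric]) (auto simp: mult.commute)
    finally show ?thesis .
  qed
  show ?thesis
  proof (cases "a \<le> T")
    case True
    \<comment> \<open>The tail bound exceeds the target power of \<open>a\<close> by one factor
      \<open>a / T\<close>, which is at most 1 here.\<close>
    have "2 * V\<^sup>2 / (real (2 * m + 1) * T ^ (2 * m + 1)) = (a / T) * (2 / (2 * real m + 1) * a ^ (2 * m + 1) * (1 / T) ^ (2 * m))"
      unfolding V2 using T by (simp add: field_simps power_add)
    also have "\<dots> \<le> 1 * (4 * (real m + 1) / (2 * real m + 1) * a ^ (2 * m + 1) * (1 / T) ^ (2 * m))"
      using True T a by (intro mult_mono divide_right_mono) auto
    finally show ?thesis unfolding aP using tail[OF T] by (auto intro: order_trans ennreal_leI)
  next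
    case False
    then have a0: "a > 0" "T < a" using T by auto
    \<comment> \<open>Up to \<open>a\<close> the squared function is bounded by 1, which costs
      \<open>2 * a\<close>; beyond \<open>a\<close> the decay costs
      \<open>2 * a / (2 * m + 1)\<close>. Their sum is the source of the constant
      \<open>4 * (m + 1) / (2 * m + 1)\<close>.\<close>
    have "(\<integral>\<^sup>+t. ennreal ((\<phi> t)\<^sup>2) * indicator (- {-T..T}) t \<partial>lborel)
      \<le> (\<integral>\<^sup>+t. indicator {-a..a} t + ennreal ((\<phi> t)\<^sup>2) * indicator (- {-a..a}) t \<partial>lborel)"
    proof (intro nn_integral_mono)
      fix t
      have "(\<phi> t)\<^sup>2 \<le> 1" using \<phi> by (simp add: power_le_one)
      then show "ennreal ((\<phi> t)\<^sup>2) * indicator (- {-T..T}) t \<le> indicator {-a..a} t + ennreal ((\<phi> t)\<^sup>2) * indicator (- {-a..a}) t"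
        by (auto simp: indicator_def)
    qed
    also have "\<dots> = ennreal (2 * a) + (\<integral>\<^sup>+t. ennreal ((\<phi> t)\<^sup>2) * indicator (- {-a..a}) t \<partial>lborel)"
      using a0 by (subst nn_integral_add) auto
    also have "\<dots> \<le> ennreal (2 * a) + ennreal (2 * V\<^sup>2 / (real (2 * m + 1) * a ^ (2 * m + 1)))"
      by (intro add_left_mono tail a0)
    also have "\<dots> = ennreal (4 * (real m + 1) / (2 * real m + 1) * a)"
    proof -
      have "2 * V\<^sup>2 / (real (2 * m + 1) * a ^ (2 * m + 1)) = 2 * a / (2 * real m + 1)"
        unfolding V2 using a0 by simp
      moreover have "2 * a + 2 * a / (2 * real m + 1) = 4 * (real m + 1) / (2 * real m + 1) * a"
        by (simp add: field_simps)
      ultimately show ?thesis using a0 by (simp add: ennreal_plus[symmetric] del: ennreal_plus)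
    qed
    also have "\<dots> \<le> ennreal (4 * (real m + 1) / (2 * real m + 1) * a ^ (2 * m + 1) * (1 / T) ^ (2 * m))"
    proof (rule ennreal_leI)
      \<comment> \<open>As \<open>a > T\<close>, inserting the factor
        \<open>(a / T) ^ (2 * m)\<close> only enlarges the bound and gives it the form of the other
        case.\<close>
      have "1 \<le> (a / T) ^ (2 * m)" using a0 T by (intro one_le_power) simp
      then have "4 * (real m + 1) / (2 * real m + 1) * a * 1 \<le> 4 * (real m + 1) / (2 * real m + 1) * a * (a / T) ^ (2 * m)"
        using a0 by (intro mult_left_mono) auto
      then show "4 * (real m + 1) / (2 * real m + 1) * a \<le> 4 * (real m + 1) / (2 * real m + 1) * a ^ (2 * m + 1) * (1 / T) ^ (2 * m)"
        by (simp add: power_divide)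
    qed
    finally show ?thesis unfolding aP .
  qed
qed

section \<open>The estimation error on the Fourier side\<close>

text \<open>Adding the two bounds gives a multiple of the Cauchy density as dominating
  function.\<close>

lemma integrable_of_quadratic_decay:
  fixes f :: "real \<Rightarrow> complex"
  assumes [measurable]: "f \<in> borel_measurable borel"
    and "\<And>t. cmod (f t) \<le> 1" and "\<And>t. t\<^sup>2 * cmod (f t) \<le> C"
  shows "integrable lborel f"
proof (rule Bochner_Integration.integrable_bound)
  show "integrable lborel (\<lambda>t::real. (1 + C) * (1 / (1 + t\<^sup>2)))"
    by (intro integrable_mult_right integrable_inverse_one_plus_square)
  have "cmod (f t) \<le> (1 + C) * (1 / (1 + t\<^sup>2))" for t
  proof -
    have "(1 + t\<^sup>2) * cmod (f t) \<le> 1 + C"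
      using assms(2,3)[of t] by (simp add: distrib_right)
    moreover have "0 < 1 + t\<^sup>2" by (simp add: add_pos_nonneg)
    ultimately show ?thesis by (simp add: pos_le_divide_eq mult.commute)
  qed
  then show "AE t in lborel. norm (f t) \<le> norm ((1 + C) * (1 / (1 + t\<^sup>2)))"
    by (intro AE_I2) (metis abs_ge_self order_trans real_norm_def)
qed measurable

text \<open>The kernel centred at \<open>y\<close> is the inverse transform of a character cut off
  at \<open>1 / h\<close>: the character moves the evaluation point to \<open>y - x\<close>, and
  \<open>sinc\<close> is even.\<close>

lemma sinc_kernel_eq_fourier:
  assumes "h > 0"
  shows "complex_of_real (sinc_kernel ((x - y) / h) / h)
    = fourier (\<lambda>t. complex_of_real (indicator {-1/h..1/h} t) * cis (t * y)) (- x) / (2 * pi)"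
proof -
  have "fourier (\<lambda>t. complex_of_real (indicator {-1/h..1/h} t) * cis (t * y)) (- x)
    = fourier (\<lambda>t. complex_of_real (indicator {-(1/h)..1/h} t)) (y - x)"
    unfolding fourier_def
  proof (rule Bochner_Integration.integral_cong[OF refl])
    fix t
    have "cis ((y - x) * t) = cis (- x * t) * cis (t * y)"
      by (simp add: cis_mult algebra_simps)
    then show "cis (- x * t) * (complex_of_real (indicator {- 1 / h..1 / h} t) * cis (t * y))
       = cis ((y - x) * t) * complex_of_real (indicator {- (1 / h)..1 / h} t)"
      by simp
  qed
  also have "\<dots> = complex_of_real (2 * (1/h) * sinc (1/h * (y - x)))"
    by (rule fourier_indicator_interval) (use assms in simp)
  also have "sinc (1/h * (y - x)) = sinc ((x - y) / h)"
  proof -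
    have "1/h * (y - x) = - ((x - y) / h)" using assms by (simp add: field_simps)
    then show ?thesis by simp
  qed
  also have "complex_of_real (2 * (1/h) * sinc ((x - y) / h)) / (2 * pi) = complex_of_real (sinc_kernel ((x - y) / h) / h)"
    using assms unfolding sinc_kernel_def by (simp only: of_real_divide of_real_mult) (simp add: field_simps)
  finally show ?thesis by simp
qed

text \<open>For each fixed outcome the error is the inverse transform of the truncated empirical
  characteristic function minus that of \<open>p\<close>. The Plancherel inequality contributes
  \<open>2 * pi\<close> against the squared normalisation, which leaves
  \<open>1 / (2 * pi)\<close>.\<close>

lemma nn_integral_sinc_estimator_error_le:
  fixes p :: "real \<Rightarrow> real" and X :: "nat \<Rightarrow> 'a \<Rightarrow> real"
  assumes p: "integrable lborel p" and cont: "continuous_on UNIV p" and nonneg: "\<And>x. 0 \<le> p x"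
    and f: "integrable lborel (fourier (\<lambda>x. complex_of_real (p x)))"
    and h: "h > 0" and n: "n \<ge> 1"
  shows "(\<integral>\<^sup>+x. ennreal ((sinc_estimator X n h \<omega> x - p x)\<^sup>2) \<partial>lborel)
    \<le> ennreal (1 / (2 * pi)) * (\<integral>\<^sup>+t. ennreal ((cmod (complex_of_real (indicator {-1/h..1/h} t)
        * ((\<Sum>j=1..n. cis (t * X j \<omega>)) / n) - fourier (\<lambda>x. complex_of_real (p x)) t))\<^sup>2) \<partial>lborel)"
proof -
  let ?f = "fourier (\<lambda>x. complex_of_real (p x))"
  let ?I = "\<lambda>t. complex_of_real (indicator {-1/h..1/h} t)"
  define g where "g t = ?I t * ((\<Sum>j=1..n. cis (t * X j \<omega>)) / n) - ?f t" for t
  have intI: "integrable lborel (\<lambda>t. ?I t * cis (t * y))" for y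
  proof -
    have "integrable lborel ?I"
      by (intro integrable_of_real integrable_real_indicator) (auto simp: emeasure_lborel_Icc_eq)
    from integrable_cis_mult[OF this, of y] show ?thesis by (simp add: mult.commute)
  qed
  have g_eq: "g = (\<lambda>t. (\<Sum>j=1..n. ?I t * cis (t * X j \<omega>)) / n - ?f t)"
    by (simp add: g_def fun_eq_iff sum_distrib_left)
  have g: "integrable lborel g"
    unfolding g_eq by (intro Bochner_Integration.integrable_diff integrable_divide Bochner_Integration.integrable_sum intI f)
  \<comment> \<open>By linearity: each summand is a kernel, and the last term is \<open>p x\<close>
    by Fourier inversion.\<close>
  have err: "complex_of_real (sinc_estimator X n h \<omega> x - p x) = fourier g (- x) / (2 * pi)" for x
  proof -
    have "fourier g (- x) = (\<Sum>j=1..n. fourier (\<lambda>t. ?I t * cis (t * X j \<omega>)) (- x)) / n - fourier ?f (- x)"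
      unfolding g_eq
      by (simp only: fourier_diff fourier_divide fourier_sum intI f Bochner_Integration.integrable_sum integrable_divide)
    then have "fourier g (- x) / (2 * pi) = (\<Sum>j=1..n. fourier (\<lambda>t. ?I t * cis (t * X j \<omega>)) (- x) / (2 * pi)) / n - fourier ?f (- x) / (2 * pi)"
      by (simp only: diff_divide_distrib sum_divide_distrib[symmetric] divide_divide_eq_left mult.commute)
    also have "\<dots> = (\<Sum>j=1..n. complex_of_real (sinc_kernel ((x - X j \<omega>) / h) / h)) / n - complex_of_real (p x)"
      by (rule arg_cong2[where f=minus, OF arg_cong[where f="\<lambda>s. s / complex_of_nat n",
            OF sum.cong[OF refl sinc_kernel_eq_fourier[OF h, symmetric]]] fourier_inversion[OF p cont nonneg f, symmetric]])
    also have "\<dots> = complex_of_real (sinc_estimator X n h \<omega> x - p x)"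
      unfolding sinc_estimator_def by (simp add: sum_divide_distrib[symmetric] sum_distrib_left mult.commute)
    finally show ?thesis by simp
  qed
  have err2: "(sinc_estimator X n h \<omega> x - p x)\<^sup>2 = 1 / (2 * pi)\<^sup>2 * (cmod (fourier g (- x)))\<^sup>2" for x
  proof -
    have "\<bar>sinc_estimator X n h \<omega> x - p x\<bar> = cmod (fourier g (- x)) / (2 * pi)"
      using arg_cong[OF err[of x], of cmod] by (simp only: norm_of_real) (simp add: norm_divide norm_mult)
    then have "\<bar>sinc_estimator X n h \<omega> x - p x\<bar>\<^sup>2 = (cmod (fourier g (- x)) / (2 * pi))\<^sup>2" by simp
    then show ?thesis by (simp add: power_divide)
  qed
  have [measurable]: "g \<in> borel_measurable borel" using g by auto
  have "(\<integral>\<^sup>+x. ennreal ((sinc_estimator X n h \<omega> x - p x)\<^sup>2) \<partial>lborel)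
     = ennreal (1 / (2 * pi)\<^sup>2) * (\<integral>\<^sup>+x. ennreal ((cmod (fourier g (0 + (-1) * x)))\<^sup>2) \<partial>lborel)"
    unfolding err2 by (subst ennreal_mult) (auto intro!: nn_integral_cmult)
  also have "(\<integral>\<^sup>+x. ennreal ((cmod (fourier g (0 + (-1) * x)))\<^sup>2) \<partial>lborel) = (\<integral>\<^sup>+x. ennreal ((cmod (fourier g x))\<^sup>2) \<partial>lborel)"
    by (subst (2) nn_integral_real_affine[where c="-1" and t=0]) auto
  also have "ennreal (1 / (2 * pi)\<^sup>2) * (\<integral>\<^sup>+x. ennreal ((cmod (fourier g x))\<^sup>2) \<partial>lborel)
     \<le> ennreal (1 / (2 * pi)\<^sup>2) * (ennreal (2 * pi) * (\<integral>\<^sup>+t. ennreal ((cmod (g t))\<^sup>2) \<partial>lborel))"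
    by (intro mult_left_mono plancherel_le g) simp
  also have "\<dots> = ennreal (1 / (2 * pi)) * (\<integral>\<^sup>+t. ennreal ((cmod (g t))\<^sup>2) \<partial>lborel)"
    unfolding mult.assoc[symmetric] by (subst ennreal_mult'[symmetric]) (auto simp: power2_eq_square)
  finally show ?thesis unfolding g_def .
qed

section \<open>Mean square error of the empirical characteristic function\<close>

lemma (in prob_space) expectation_cis:
  fixes p :: "real \<Rightarrow> real"
  assumes X: "distributed M lborel X (\<lambda>x. ennreal (p x))"
    and nonneg: "\<And>x. 0 \<le> p x" and [measurable]: "p \<in> borel_measurable borel"
  shows "(\<integral>\<omega>. cis (t * X \<omega>) \<partial>M) = fourier (\<lambda>x. complex_of_real (p x)) t"
proof -
  have [measurable]: "X \<in> borel_measurable M" using distributed_measurable[OF X] by simp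
  have "(\<integral>\<omega>. cis (t * X \<omega>) \<partial>M) = (\<integral>x. cis (t * x) \<partial>distr M lborel X)"
    by (subst integral_distr) auto
  also have "\<dots> = (\<integral>x. p x *\<^sub>R cis (t * x) \<partial>lborel)"
    unfolding distributed_distr_eq_density[OF X] using nonneg by (subst integral_density) auto
  finally show ?thesis by (simp add: fourier_def scaleR_conv_of_real mult.commute)
qed

text \<open>The centred variables \<open>Y j\<close> have second moment
  \<open>1 - (cmod ?f)\<^sup>2\<close>, at most 1, because \<open>cis\<close> has modulus 1.
  Additivity over independent terms gives at most \<open>n\<close>, to be divided by the square of
  \<open>n\<close>.\<close>

lemma (in prob_space) empirical_char_square_error_le:
  fixes p :: "real \<Rightarrow> real" and X :: "nat \<Rightarrow> 'a \<Rightarrow> real"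
  assumes n: "n \<ge> 1" and indep: "indep_vars (\<lambda>_. borel) X {1..n}"
    and nonneg: "\<And>x. 0 \<le> p x" and meas: "p \<in> borel_measurable borel"
    and X: "\<And>j. j \<in> {1..n} \<Longrightarrow> distributed M lborel (X j) (\<lambda>x. ennreal (p x))"
  shows "(\<integral>\<^sup>+\<omega>. ennreal ((cmod ((\<Sum>j=1..n. cis (t * X j \<omega>)) / n - fourier (\<lambda>x. complex_of_real (p x)) t))\<^sup>2) \<partial>M)
    \<le> ennreal (1 / n)"
proof -
  let ?f = "fourier (\<lambda>x. complex_of_real (p x)) t"
  define Y where "Y j \<omega> = cis (t * X j \<omega>) - ?f" for j \<omega>
  have rv: "X j \<in> borel_measurable M" if "j \<in> {1..n}" for j
    using distributed_measurable[OF X[OF that]] by simp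
  have indep_Y: "indep_vars (\<lambda>_. borel) Y {1..n}"
    unfolding Y_def by (rule indep_vars_compose2[OF indep]) measurable
  have int_cis: "integrable M (\<lambda>\<omega>. cis (t * X j \<omega>))" if "j \<in> {1..n}" for j
    using rv[OF that] by (intro integrable_const_bound[of _ 1]) auto
  have int_Y: "integrable M (Y j)" if "j \<in> {1..n}" for j
    unfolding Y_def using int_cis[OF that] by simp
  have mean: "(\<integral>\<omega>. Y j \<omega> \<partial>M) = 0" if "j \<in> {1..n}" for j
    unfolding Y_def using int_cis[OF that] expectation_cis[OF X[OF that] nonneg meas]
    by (simp add: prob_space)
  have normY: "(cmod (Y j \<omega>))\<^sup>2 = 1 + (cmod ?f)\<^sup>2 - 2 * Re (cis (t * X j \<omega>) * cnj ?f)" for j \<omega>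
    unfolding Y_def cmod_power2 by (simp add: power2_eq_square algebra_simps)
  have int_sq: "integrable M (\<lambda>\<omega>. (cmod (Y j \<omega>))\<^sup>2)" if "j \<in> {1..n}" for j
    unfolding normY using int_cis[OF that] by (intro Bochner_Integration.integrable_diff integrable_const integrable_mult_right integrable_Re integrable_mult_left)
  have gen: "(\<integral>\<omega>. a - 2 * Re (W \<omega>) \<partial>M) = a - 2 * Re (\<integral>\<omega>. W \<omega> \<partial>M)" if "integrable M W" for a W
    using that by (simp add: prob_space)
  have var: "(\<integral>\<omega>. (cmod (Y j \<omega>))\<^sup>2 \<partial>M) \<le> 1" if "j \<in> {1..n}" for j
  proof -
    have "(\<integral>\<omega>. (cmod (Y j \<omega>))\<^sup>2 \<partial>M) = 1 + (cmod ?f)\<^sup>2 - 2 * Re (\<integral>\<omega>. cis (t * X j \<omega>) * cnj ?f \<partial>M)"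
      unfolding normY by (rule gen) (use int_cis[OF that] in simp)
    also have "(\<integral>\<omega>. cis (t * X j \<omega>) * cnj ?f \<partial>M) = ?f * cnj ?f"
      using expectation_cis[OF X[OF that] nonneg meas] by simp
    also have "Re (?f * cnj ?f) = (cmod ?f)\<^sup>2"
      unfolding complex_norm_square[symmetric] by (rule Re_complex_of_real)
    finally show ?thesis by simp
  qed
  have eq: "(cmod ((\<Sum>j=1..n. cis (t * X j \<omega>)) / n - ?f))\<^sup>2 = (cmod (\<Sum>j=1..n. Y j \<omega>))\<^sup>2 / (real n)\<^sup>2" for \<omega>
  proof -
    have "(\<Sum>j=1..n. cis (t * X j \<omega>)) / n - ?f = (\<Sum>j=1..n. Y j \<omega>) / n"
      using n by (simp add: Y_def sum_subtractf field_simps)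
    then show ?thesis by (simp add: norm_divide power_divide)
  qed
  note sq = indep_vars_norm_sum_square[OF _ indep_Y int_Y int_sq mean]
  have "(\<integral>\<^sup>+\<omega>. ennreal ((cmod ((\<Sum>j=1..n. cis (t * X j \<omega>)) / n - ?f))\<^sup>2) \<partial>M)
     = ennreal (\<integral>\<omega>. (cmod (\<Sum>j=1..n. Y j \<omega>))\<^sup>2 / (real n)\<^sup>2 \<partial>M)"
    unfolding eq by (intro nn_integral_eq_integral integrable_divide sq(1)) auto
  also have "(\<integral>\<omega>. (cmod (\<Sum>j=1..n. Y j \<omega>))\<^sup>2 / (real n)\<^sup>2 \<partial>M) = (\<Sum>j=1..n. \<integral>\<omega>. (cmod (Y j \<omega>))\<^sup>2 \<partial>M) / (real n)\<^sup>2"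
    using sq(2) by simp
  also have "\<dots> \<le> real n / (real n)\<^sup>2"
  proof (rule divide_right_mono)
    have "(\<Sum>j=1..n. \<integral>\<omega>. (cmod (Y j \<omega>))\<^sup>2 \<partial>M) \<le> (\<Sum>j=1..n. 1)" by (intro sum_mono var)
    then show "(\<Sum>j=1..n. \<integral>\<omega>. (cmod (Y j \<omega>))\<^sup>2 \<partial>M) \<le> real n" by simp
  qed simp
  also have "real n / (real n)\<^sup>2 = 1 / n" using n by (simp add: power2_eq_square)
  finally show ?thesis by (simp add: ennreal_leI)
qed

section \<open>The risk bound: combining variance, bias and bandwidth\<close>

theorem theorem7:
  fixes M :: "'a measure" and X :: "nat \<Rightarrow> 'a \<Rightarrow> real" and p :: "real \<Rightarrow> real"
    and m n :: nat and V h\<^sub>0 :: real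
  assumes "prob_space M"
    and "n \<ge> 1"
    and "prob_space.indep_vars M (\<lambda>_. borel) X {1..n}"
    and "\<And>x. 0 \<le> p x"
    and "\<And>j. j \<in> {1..n} \<Longrightarrow> distributed M lborel (X j) (\<lambda>x. ennreal (p x))"
    and "m \<ge> 1"
    and "times_differentiable m p"
    and "0 \<le> V"
    and "total_variation ((deriv ^^ m) p) = ennreal V"
    and "h\<^sub>0 > 0"
  shows "MISE M (sinc_estimator X n (h\<^sub>0 * real n powr (- 1 / (2 * real m + 1)))) p
    \<le> ennreal (1 / (2 * pi)
        * (4 * (real m + 1) / (2 * real m + 1)
             * V powr ((2 * real m + 1) / (real m + 1)) * h\<^sub>0 ^ (2 * m)
           + 2 / h\<^sub>0)
        * real n powr (- 2 * real m / (2 * real m + 1)))"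
proof -
  interpret prob_space M by fact
  interpret pair_sigma_finite M lborel ..
  note n = assms(2) and indep = assms(3) and nonneg = assms(4) and X = assms(5)
  note rv = distributed_measurable[OF X]
  have "p differentiable_on UNIV"
    using assms(6,7) unfolding times_differentiable_def by (metis funpow_0 less_le_trans zero_less_one)
  then have cont: "continuous_on UNIV p" by (rule differentiable_imp_continuous_on)
  then have [measurable]: "p \<in> borel_measurable borel" by (rule borel_measurable_continuous_onI)
  have X1: "distributed M lborel (X 1) (\<lambda>x. ennreal (p x))" using n by (intro X) simp
  \<comment> \<open>The mass of \<open>p\<close> is read off from the law of \<open>X 1\<close>, an
    index available since \<open>n \<ge> 1\<close>.\<close>
  have "(\<integral>\<^sup>+x. ennreal (p x) \<partial>lborel) = emeasure (distr M lborel (X 1)) UNIV"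
    unfolding distributed_distr_eq_density[OF X1] by (simp add: emeasure_density)
  also have "\<dots> = 1"
    using distributed_measurable[OF X1] by (simp add: emeasure_distr emeasure_space_1)
  finally have p1: "(\<integral>\<^sup>+x. ennreal (p x) \<partial>lborel) = 1" .
  then have p: "integrable lborel p" using nonneg by (intro integrableI_nonneg) auto
  have p_int: "(\<integral>x. p x \<partial>lborel) = 1"
    using p1 nonneg by (subst integral_eq_nn_integral) auto
  define f where "f = fourier (\<lambda>x. complex_of_real (p x))"
  have [measurable]: "f \<in> borel_measurable borel" unfolding f_def by measurable
  have f1: "cmod (f t) \<le> 1" for t
    using norm_fourier_le[of "\<lambda>x. complex_of_real (p x)" t] nonneg p_int unfolding f_def by simp
  have decay: "\<bar>t\<bar> ^ Suc m * cmod (f t) \<le> V" for t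
    unfolding f_def by (rule fourier_decay[OF assms(7) p assms(9,8)])
  \<comment> \<open>The decay has order \<open>m + 1 \<ge> 2\<close>, hence is at least quadratic
    for \<open>\<bar>t\<bar> > 1\<close>; for smaller \<open>t\<close> the bound by 1 is enough.
    This makes \<open>f\<close> integrable, as inversion requires.\<close>
  have "t\<^sup>2 * cmod (f t) \<le> 1 + V" for t
  proof (cases "\<bar>t\<bar> \<le> 1")
    case True
    then have "t\<^sup>2 * cmod (f t) \<le> 1 * 1" using f1 by (intro mult_mono) (auto simp: abs_square_le_1)
    then show ?thesis using assms(8) by simp
  next
    case False
    then have "\<bar>t\<bar>\<^sup>2 \<le> \<bar>t\<bar> ^ Suc m" using assms(6) by (intro power_increasing) auto
    then have "t\<^sup>2 * cmod (f t) \<le> \<bar>t\<bar> ^ Suc m * cmod (f t)" by (intro mult_right_mono) auto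
    then show ?thesis using decay[of t] by simp
  qed
  then have f: "integrable lborel f" using f1 by (intro integrable_of_quadratic_decay[of f "1 + V"]) auto

  define h where "h = h\<^sub>0 * real n powr (- 1 / (2 * real m + 1))"
  have h: "h > 0" using assms(10) n by (simp add: h_def)
  define S where "S \<omega> t = (\<Sum>j=1..n. cis (t * X j \<omega>)) / n" for \<omega> t
  \<comment> \<open>Joint measurability in the outcome and the frequency, for exchanging expectation
    and integral.\<close>
  have [measurable]: "(\<lambda>(\<omega>, t). S \<omega> t) \<in> borel_measurable (M \<Otimes>\<^sub>M borel)"
  proof -
    have "(\<lambda>(\<omega>, t). cis (t * X j \<omega>)) \<in> borel_measurable (M \<Otimes>\<^sub>M borel)" if "j \<in> {1..n}" for j
    proof -
      have [measurable]: "X j \<in> borel_measurable M" using rv[OF that] by simp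
      show ?thesis by measurable
    qed
    then show ?thesis unfolding S_def case_prod_beta
      by (intro borel_measurable_divide borel_measurable_sum) auto
  qed
  define G where "G \<omega> t = ennreal ((cmod (complex_of_real (indicator {-1/h..1/h} t) * S \<omega> t - f t))\<^sup>2)" for \<omega> t
  have [measurable]: "(\<lambda>(\<omega>, t). G \<omega> t) \<in> borel_measurable (M \<Otimes>\<^sub>M lborel)"
    unfolding G_def by measurable
  define C where "C = 4 * (real m + 1) / (2 * real m + 1) * V powr ((2 * real m + 1) / (real m + 1))"
  have C: "C \<ge> 0" by (simp add: C_def)

  have "MISE M (sinc_estimator X n h) p \<le> (\<integral>\<^sup>+\<omega>. ennreal (1 / (2 * pi)) * (\<integral>\<^sup>+t. G \<omega> t \<partial>lborel) \<partial>M)"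
    unfolding MISE_def G_def S_def f_def
    by (intro nn_integral_mono nn_integral_sinc_estimator_error_le p cont nonneg h n f[unfolded f_def])
  also have "\<dots> = ennreal (1 / (2 * pi)) * (\<integral>\<^sup>+\<omega>. (\<integral>\<^sup>+t. G \<omega> t \<partial>lborel) \<partial>M)"
    by (rule nn_integral_cmult) measurable
  also have "(\<integral>\<^sup>+\<omega>. (\<integral>\<^sup>+t. G \<omega> t \<partial>lborel) \<partial>M) = (\<integral>\<^sup>+t. (\<integral>\<^sup>+\<omega>. G \<omega> t \<partial>M) \<partial>lborel)"
    by (rule Fubini'[symmetric]) measurable
  \<comment> \<open>Variance and bias separate by frequency: inside the band the expected squared
    error is at most \<open>1 / n\<close>, outside it the estimator contributes nothing and the
    deterministic error \<open>f t\<close> remains.\<close>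
  also have "\<dots> \<le> (\<integral>\<^sup>+t. ennreal (1 / n) * indicator {-(1/h)..1/h} t + ennreal ((cmod (f t))\<^sup>2) * indicator (- {-(1/h)..1/h}) t \<partial>lborel)"
  proof (rule nn_integral_mono)
    fix t
    show "(\<integral>\<^sup>+\<omega>. G \<omega> t \<partial>M) \<le> ennreal (1 / n) * indicator {-(1/h)..1/h} t + ennreal ((cmod (f t))\<^sup>2) * indicator (- {-(1/h)..1/h}) t"
    proof (cases "t \<in> {-(1/h)..1/h}")
      case True
      then show ?thesis
        using empirical_char_square_error_le[OF n indep nonneg _ X, of t] by (simp add: G_def S_def f_def)
    next
      case False
      then show ?thesis by (auto simp: G_def emeasure_space_1)
    qed
  qed
  also have "\<dots> = ennreal (1 / n) * ennreal (2 / h) + (\<integral>\<^sup>+t. ennreal ((cmod (f t))\<^sup>2) * indicator (- {-(1/h)..1/h}) t \<partial>lborel)"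
    using h by (subst nn_integral_add) (auto simp: nn_integral_cmult_indicator)
  \<comment> \<open>The tail bound is used with cutoff \<open>T = 1 / h\<close>, hence the nested
    reciprocal.\<close>
  also have "\<dots> \<le> ennreal (1 / n) * ennreal (2 / h) + ennreal (C * (1 / (1 / h)) ^ (2 * m))"
    unfolding C_def using f1 decay assms(8) h by (intro add_left_mono nn_integral_square_tail_le) auto
  also have "\<dots> = ennreal (2 / (n * h) + C * h ^ (2 * m))"
    using h C by (simp add: ennreal_mult'[symmetric] ennreal_plus[symmetric] del: ennreal_plus)
  finally have "MISE M (sinc_estimator X n h) p \<le> ennreal (1 / (2 * pi)) * ennreal (2 / (n * h) + C * h ^ (2 * m))"
    by (simp add: mult_left_mono)
  also have "\<dots> = ennreal (1 / (2 * pi) * (2 / (n * h) + C * h ^ (2 * m)))"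
    by (rule ennreal_mult'[symmetric]) simp
  also have "1 / (2 * pi) * (2 / (n * h) + C * h ^ (2 * m))
      = 1 / (2 * pi) * (C * h\<^sub>0 ^ (2 * m) + 2 / h\<^sub>0) * real n powr (- 2 * real m / (2 * real m + 1))"
  proof -
    \<comment> \<open>The exponent of the bandwidth balances the two terms: the bias scales with
      \<open>\<alpha> * 2 * m\<close> and the variance with \<open>- (1 + \<alpha>)\<close>, and for
      this \<open>\<alpha>\<close> both are \<open>- 2 * m / (2 * m + 1)\<close>.\<close>
    define \<alpha> where "\<alpha> = - 1 / (2 * real m + 1)"
    have \<alpha>: "\<alpha> * real (2 * m) = - 2 * real m / (2 * real m + 1)" "- (1 + \<alpha>) = - 2 * real m / (2 * real m + 1)"
      by (simp_all add: \<alpha>_def field_simps)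
    have hm: "h ^ (2 * m) = h\<^sub>0 ^ (2 * m) * real n powr (- 2 * real m / (2 * real m + 1))"
      unfolding h_def \<alpha>_def[symmetric] \<alpha>(1)[symmetric] power_mult_distrib
      using n by (subst powr_powr[symmetric], subst powr_realpow) auto
    have "real n * h = h\<^sub>0 * real n powr (1 + \<alpha>)"
      unfolding h_def \<alpha>_def[symmetric] using n by (simp add: powr_add)
    then have "2 / (n * h) = 2 / h\<^sub>0 * real n powr (- (1 + \<alpha>))"
      by (simp only: powr_minus divide_inverse inverse_mult_distrib mult.assoc)
    then show ?thesis unfolding hm \<alpha>(2) by (simp add: algebra_simps)
  qed
  finally show ?thesis unfolding h_def C_def .
qed

end
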